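(* Every set $A\subseteq\mathbb{N}$ satisfying $$\sum_{a\in A}\|a\theta\|=\infty\qquad\text{for all }\theta\in\mathbb{T}\setminus\{0\}$$ and the inequality $|A\cap(2^k,2^{k+1}]|\ge5$ for every sufficiently large integer $k$ is strongly complete.
   Context: $\mathbb{N}=\{1,2,3,\ldots\}$ and $\mathbb{T}=\mathbb{R}/\mathbb{Z}$. $\|x\|$ denotes the distance from $x$ to the nearest integer. A set $A\subseteq\mathbb{N}$ is complete if every sufficiently large positive integer is a sum of distinct elements of $A$, and strongly complete if $A\setminus B$ is complete for every finite subset $B\subseteq A$. *)

theory Defs
  imports "HOL-Analysis.Analysis"
begin

text \<open>
  The distance to the nearest integer. At half-integers both neighbours are nearest, so the
  tie-breaking rule of \<^const>\<open>round\<close> is immaterial. The function has period 1; it is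
  therefore a function on the circle, and a nonzero point of the circle is given by
  a real representative that is not an integer.
\<close>

definition dist_nearest_int :: "real \<Rightarrow> real" where
  "dist_nearest_int x = \<bar>x - of_int (round x)\<bar>"

definition complete_set :: "nat set \<Rightarrow> bool" where
  "complete_set A \<longleftrightarrow> (\<forall>\<^sub>F n in at_top. \<exists>S. finite S \<and> S \<subseteq> A \<and> n = \<Sum>S)"

definition strongly_complete_set :: "nat set \<Rightarrow> bool" where
  "strongly_complete_set A \<longleftrightarrow> (\<forall>B. finite B \<and> B \<subseteq> A \<longrightarrow> complete_set (A - B))"

end

theory Submission
  imports Defs
begin

text \<open>
  Removing a finite set from \<open>A\<close> changes neither hypothesis, so it is enough that \<open>A\<close> is complete.
  From each octave \<open>(2^k, 2^(k+1)]\<close> two elements of \<open>A\<close> are put into a set \<open>B\<close>, two into a set \<open>C\<close>,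
  and all others into \<open>E\<close>. Two elements per octave force the subset sums of \<open>B\<close>, and those of \<open>C\<close>,
  to have bounded gaps (\<open>subset_sums_gap\<close>). If the subset sums of \<open>C \<union> E\<close> contain a run of
  consecutive integers as long as the gaps of \<open>B\<close>, then every large integer is a subset sum of
  \<open>A\<close>. So the aim is to find arbitrarily long runs among the subset sums of \<open>C \<union> E\<close>; the set \<open>C\<close>
  only has to provide positive density, and \<open>E\<close> has to break every periodicity.

  For this, \<open>E\<close> must inherit the divergence: the sum of \<open>\<parallel>a\<theta>\<parallel>\<close> over \<open>E\<close> has to be infinite for all
  non-integral \<open>\<theta>\<close>. The fifth element of each octave makes this possible
  (\<open>divergent_remainder\<close>). A sequence with bounded ratios can stay close to the integers after
  multiplication by \<open>\<theta>\<close> for countably many \<open>\<theta>\<close> only, and countably many conditions can be met by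
  a diagonal choice of the four elements that are removed.

  The long runs come from a density increment argument (\<open>subset_sums_contain_long_runs\<close>). Choose
  a finite part \<open>F\<close> of \<open>E\<close> such that the set \<open>T\<close> of subset sums of \<open>C \<union> F\<close> has nearly the largest
  density that is possible. Then \<open>T\<close> is almost invariant under translation by every sum \<open>h\<close> of
  elements of \<open>E\<close> beyond \<open>F\<close>, for otherwise adjoining \<open>T + h\<close> would increase the density too much.
  In terms of the Fourier transform, \<open>T\<close> has little mass at the frequencies \<open>\<theta>\<close> for which \<open>h\<theta>\<close> is
  far from an integer. Divergence supplies, for each \<open>\<theta>\<close>, a block of elements of \<open>E\<close> whose sum
  moves \<open>\<theta>\<close> far away, and a compactness argument reduces to two finite families of disjoint
  blocks that deal with all \<open>\<theta>\<close> away from the integers (\<open>two_families\<close>). Averaging over all sums of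
  blocks of a family costs only a constant factor, whatever the size of the family
  (\<open>family_average\<close>). So the mass of \<open>T\<close> is concentrated near frequency \<open>0\<close>, which makes \<open>T\<close>
  almost invariant under translation by 1. A set of positive density with this property contains
  long runs.
\<close>

section \<open>Subset sums with bounded gaps\<close>

abbreviation (input) octave :: "nat \<Rightarrow> nat set" where
  "octave k \<equiv> {2 ^ k <.. 2 ^ (k + 1)}"

lemma octave_unique:
  assumes "a \<in> octave k" "a \<in> octave k'"
  shows "k = k'"
proof -
  have "(2::nat) ^ k < 2 ^ (k' + 1)" "(2::nat) ^ k' < 2 ^ (k + 1)"
    using assms by (auto intro: less_le_trans)
  then have "k < k' + 1" "k' < k + 1" by (meson one_less_numeral_iff power_less_imp_less_exp semiring_norm(76))+
  then show ?thesis by simp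
qed

definition subset_sums :: "nat set \<Rightarrow> nat set" where
  "subset_sums X = {\<Sum>S | S. finite S \<and> S \<subseteq> X}"

lemma subset_sums_mono: "X \<subseteq> Y \<Longrightarrow> subset_sums X \<subseteq> subset_sums Y"
  unfolding subset_sums_def by blast

lemma subset_sums_add:
  assumes "X \<inter> Y = {}" "s \<in> subset_sums X" "t \<in> subset_sums Y"
  shows "s + t \<in> subset_sums (X \<union> Y)"
proof -
  obtain S T where "finite S" "S \<subseteq> X" "s = \<Sum>S" "finite T" "T \<subseteq> Y" "t = \<Sum>T"
    using assms(2,3) unfolding subset_sums_def by blast
  moreover from this have "\<Sum>(S \<union> T) = \<Sum>S + \<Sum>T"
    using assms(1) by (intro sum.union_disjoint) auto
  ultimately show ?thesis
    unfolding subset_sums_def by (metis (mono_tags, lifting) finite_UnI mem_Collect_eq sup_mono)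
qed

lemma obtain_two_in:
  assumes "card (Y :: nat set) \<ge> 2"
  obtains x y where "x \<in> Y" "y \<in> Y" "x \<noteq> y"
  using assms by (metis card_2_iff' obtain_subset_with_card_n subset_iff)

text \<open>
  A greedy representation: a number below \<open>2^(k+2)\<close> drops below \<open>2^(k+1)\<close> once at most two
  elements of the octave \<open>k\<close> are subtracted, because each of them exceeds \<open>2^k\<close> and none
  exceeds \<open>2^(k+1)\<close>.
\<close>

lemma subset_sums_gap:
  assumes two: "\<And>k. k \<ge> k0 \<Longrightarrow> card (X \<inter> octave k) \<ge> 2"
  shows "\<exists>s\<in>subset_sums X. s \<le> n \<and> n < s + 2 ^ (k0 + 1)"
proof -
  have main: "\<forall>n<2 ^ (k + 1). \<exists>S\<subseteq>X \<inter> {..2 ^ k}. \<Sum>S \<le> n \<and> n < \<Sum>S + 2 ^ (k0 + 1)"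
    if "k \<ge> k0" for k
    using that
  proof (induction k rule: dec_induct)
    case base
    show ?case by (auto intro!: exI[of _ "{}"])
  next
    case (step k)
    show ?case
    proof (intro allI impI)
      fix n :: nat assume n: "n < 2 ^ (Suc k + 1)"
      obtain x y where xy: "x \<in> X \<inter> octave k" "y \<in> X \<inter> octave k" "x \<noteq> y"
        using obtain_two_in two step.hyps(1) by metis
      have extend: "\<exists>S\<subseteq>X \<inter> {..2 ^ Suc k}. \<Sum>S \<le> n \<and> n < \<Sum>S + 2 ^ (k0 + 1)"
        if Z: "Z \<subseteq> X \<inter> octave k" "\<Sum>Z \<le> n" "n - \<Sum>Z < 2 ^ (k + 1)" for Z
      proof -
        obtain S where S: "S \<subseteq> X \<inter> {..2 ^ k}" "\<Sum>S \<le> n - \<Sum>Z"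
          "n - \<Sum>Z < \<Sum>S + 2 ^ (k0 + 1)"
          using step.IH Z(3) by blast
        have "finite S" "finite Z" "S \<inter> Z = {}"
          using S(1) Z(1) finite_subset[OF S(1)] finite_subset[OF Z(1)] by fastforce+
        then have "\<Sum>(S \<union> Z) = \<Sum>S + \<Sum>Z" by (rule sum.union_disjoint)
        moreover have "S \<union> Z \<subseteq> X \<inter> {..2 ^ Suc k}"
          using S(1) Z(1) by fastforce
        ultimately show ?thesis using S Z(2) by (intro exI[of _ "S \<union> Z"]) auto
      qed
      consider "n < 2 ^ (k + 1)" | "n \<ge> 2 ^ (k + 1)" "n - x < 2 ^ (k + 1)"
        | "n - x \<ge> 2 ^ (k + 1)" by linarith
      then show "\<exists>S\<subseteq>X \<inter> {..2 ^ Suc k}. \<Sum>S \<le> n \<and> n < \<Sum>S + 2 ^ (k0 + 1)"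
      proof cases
        case 1 then show ?thesis using extend[of "{}"] by simp
      next
        case 2 then show ?thesis using extend[of "{x}"] xy by auto
      next
        case 3
        have "x > 2 ^ k" "y > 2 ^ k" "y \<le> 2 ^ (k + 1)" using xy by auto
        then show ?thesis using extend[of "{x, y}"] xy 3 n by auto
      qed
    qed
  qed
  have "n < 2 ^ n" by (rule less_exp)
  also have "(2::nat) ^ n \<le> 2 ^ (max n k0 + 1)" by (rule power_increasing) auto
  finally obtain S where "S \<subseteq> X \<inter> {..2 ^ max n k0}" "\<Sum>S \<le> n" "n < \<Sum>S + 2 ^ (k0 + 1)"
    using main[of "max n k0"] by auto
  moreover from this have "finite S" using finite_subset by blast
  ultimately show ?thesis unfolding subset_sums_def by blast
qed

section \<open>Frequencies near the integers along a sequence\<close>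

lemma dist_nearest_int_nonneg: "0 \<le> dist_nearest_int x"
  by (simp add: dist_nearest_int_def)

lemma dist_nearest_int_le_half: "dist_nearest_int x \<le> 1 / 2"
  unfolding dist_nearest_int_def using of_int_round_abs_le[of x] by (simp add: abs_minus_commute)

text \<open>
  The integer nearest to \<open>x\<^sub>j \<theta>\<close> determines the one nearest to \<open>x\<^sub>j\<^sub>+\<^sub>1 \<theta>\<close>: two frequencies
  that share the former have multiples by \<open>x\<^sub>j\<close> less than \<open>1/10\<close> apart, hence multiples by
  \<open>x\<^sub>j\<^sub>+\<^sub>1\<close> less than \<open>8/10\<close> apart, and rounding moves these by less than \<open>1/10\<close> in total. As
  \<open>x\<^sub>j\<close> grows, all these integers together pin down the frequency.
\<close>

lemma theta_determined:
  fixes x :: "nat \<Rightarrow> nat" and \<theta> \<theta>' :: real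
  assumes ratio: "\<And>j. x (Suc j) \<le> 8 * x j"
    and lim: "filterlim x at_top sequentially"
    and near: "\<And>j. dist_nearest_int (x j * \<theta>) < 1 / 20" "\<And>j. dist_nearest_int (x j * \<theta>') < 1 / 20"
    and eq: "round (x 0 * \<theta>) = round (x 0 * \<theta>')"
  shows "\<theta> = \<theta>'"
proof -
  have close: "\<bar>x j * \<theta> - x j * \<theta>'\<bar> < 1 / 10"
    if "round (x j * \<theta>) = round (x j * \<theta>')" for j
    using near(1)[of j] near(2)[of j] that unfolding dist_nearest_int_def by linarith
  have same: "round (x j * \<theta>) = round (x j * \<theta>')" for j
  proof (induction j)
    case 0 show ?case by (rule eq)
  next
    case (Suc j)
    have "\<bar>x (Suc j) * \<theta> - x (Suc j) * \<theta>'\<bar> = x (Suc j) * \<bar>\<theta> - \<theta>'\<bar>"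
      by (simp add: abs_mult flip: right_diff_distrib)
    also have "\<dots> \<le> 8 * x j * \<bar>\<theta> - \<theta>'\<bar>"
      using ratio[of j] by (intro mult_right_mono) linarith+
    also have "\<dots> = 8 * \<bar>x j * \<theta> - x j * \<theta>'\<bar>"
      by (simp add: abs_mult flip: right_diff_distrib)
    also have "\<dots> < 8 / 10" using close[OF Suc] by simp
    finally have "\<bar>x (Suc j) * \<theta> - x (Suc j) * \<theta>'\<bar> < 8 / 10" .
    then have "\<bar>real_of_int (round (x (Suc j) * \<theta>) - round (x (Suc j) * \<theta>'))\<bar> < 1"
      using near(1)[of "Suc j"] near(2)[of "Suc j"] unfolding dist_nearest_int_def by linarith
    then show ?case by linarith
  qed
  show ?thesis
  proof (rule ccontr)
    assume "\<theta> \<noteq> \<theta>'"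
    obtain n where n: "real n > 1 / \<bar>\<theta> - \<theta>'\<bar>" using reals_Archimedean2 by blast
    from lim have "eventually (\<lambda>j. x j \<ge> n) sequentially" by (simp add: filterlim_at_top)
    then obtain j where j: "x j \<ge> n" by (auto simp: eventually_sequentially)
    have "real (x j) * \<bar>\<theta> - \<theta>'\<bar> < 1 / 10"
      using close[OF same[of j]] by (simp add: abs_mult flip: right_diff_distrib)
    moreover have "real n * \<bar>\<theta> - \<theta>'\<bar> \<le> real (x j) * \<bar>\<theta> - \<theta>'\<bar>"
      using j by (intro mult_right_mono) auto
    moreover have "real n * \<bar>\<theta> - \<theta>'\<bar> > 1"
      using n \<open>\<theta> \<noteq> \<theta>'\<close> by (simp add: field_simps)
    ultimately show False by linarith
  qed
qed

text \<open>
  Past some index every distance is below \<open>1/20\<close>, so the frequency is recorded by that index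
  and one integer.
\<close>

lemma countable_small_dist:
  fixes x :: "nat \<Rightarrow> nat"
  assumes ratio: "\<And>j. x (Suc j) \<le> 8 * x j"
    and lim: "filterlim x at_top sequentially"
  shows "countable {\<theta>::real. (\<lambda>j. dist_nearest_int (x j * \<theta>)) \<longlonglongrightarrow> 0}"
proof -
  define Q where "Q n = {\<theta>::real. \<forall>j. dist_nearest_int (x (j + n) * \<theta>) < 1 / 20}" for n
  have "countable (Q n)" for n
  proof (rule countableI')
    show "inj_on (to_nat \<circ> (\<lambda>\<theta>::real. round (x n * \<theta>))) (Q n)"
    proof (rule inj_onI)
      fix s t :: real assume st: "s \<in> Q n" "t \<in> Q n"
        "(to_nat \<circ> (\<lambda>\<theta>::real. round (x n * \<theta>))) s = (to_nat \<circ> (\<lambda>\<theta>::real. round (x n * \<theta>))) t"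
      show "s = t"
      proof (rule theta_determined[of "\<lambda>j. x (j + n)" s t])
        show "filterlim (\<lambda>j. x (j + n)) at_top sequentially"
          using filterlim_compose[OF lim filterlim_add_const_nat_at_top] .
        show "round (real (x (0 + n)) * s) = round (real (x (0 + n)) * t)" using st(3) by simp
      qed (use st ratio in \<open>auto simp: Q_def\<close>)
    qed
  qed
  moreover have "{\<theta>::real. (\<lambda>j. dist_nearest_int (x j * \<theta>)) \<longlonglongrightarrow> 0} \<subseteq> (\<Union>n. Q n)"
  proof safe
    fix \<theta> :: real
    assume "(\<lambda>j. dist_nearest_int (x j * \<theta>)) \<longlonglongrightarrow> 0"
    then have "eventually (\<lambda>j. dist_nearest_int (x j * \<theta>) < 1 / 20) sequentially"
      by (rule order_tendstoD) simp
    then obtain n where "\<forall>j\<ge>n. dist_nearest_int (x j * \<theta>) < 1 / 20"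
      by (auto simp: eventually_sequentially)
    then show "\<theta> \<in> (\<Union>n. Q n)" by (auto simp: Q_def intro!: exI[of _ n])
  qed
  ultimately show ?thesis by (meson countable_UN countable_subset countableI_type)
qed

text \<open>
  Elements of consecutive octaves of equal parity have ratio at most 8, so one element from
  each of these octaves leaves only countably many frequencies.
\<close>

lemma countable_summable_parity:
  fixes Y :: "nat \<Rightarrow> nat set" and c :: bool
  assumes Y: "\<And>k. k \<ge> k0 \<Longrightarrow> Y k \<subseteq> octave k \<and> Y k \<noteq> {}"
  shows "countable {\<theta>::real. summable
           (\<lambda>k. if k \<ge> k0 \<and> even k = c then \<Sum>a\<in>Y k. dist_nearest_int (real a * \<theta>) else 0)}"
proof -
  define idx where "idx j = 2 * (k0 + j) + (if c then 0 else 1)" for j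
  define x where "x j = (SOME a. a \<in> Y (idx j))" for j
  have idx: "idx j \<ge> k0" "even (idx j) = c" "idx (Suc j) = idx j + 2" "j \<le> idx j" for j
    by (auto simp: idx_def)
  have mono: "strict_mono idx" by (simp add: strict_mono_Suc_iff idx(3))
  have xY: "x j \<in> Y (idx j)" for j
    unfolding x_def using Y[OF idx(1)] by (simp add: some_in_eq)
  have x: "2 ^ idx j < x j" "x j \<le> 2 ^ (idx j + 1)" for j
    using xY[of j] Y[OF idx(1)[of j]] by auto
  have countable_limit: "countable {\<theta>::real. (\<lambda>j. dist_nearest_int (x j * \<theta>)) \<longlonglongrightarrow> 0}"
  proof (rule countable_small_dist)
    fix j
    show "x (Suc j) \<le> 8 * x j"
      using x(1)[of j] x(2)[of "Suc j"] by (simp add: idx(3))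
  next
    have "j \<le> x j" for j
      using x(1)[of j] idx(4)[of j] less_exp[of "idx j"] by linarith
    then show "filterlim x at_top sequentially"
      by (intro filterlim_at_top_mono[OF filterlim_ident]) auto
  qed
  have tends: "(\<lambda>j. dist_nearest_int (x j * \<theta>)) \<longlonglongrightarrow> 0"
    if "summable (\<lambda>k. if k \<ge> k0 \<and> even k = c then \<Sum>a\<in>Y k. dist_nearest_int (real a * \<theta>) else 0)"
      (is "summable ?f") for \<theta> :: real
  proof (rule tendsto_sandwich[where f = "\<lambda>_. 0" and h = "\<lambda>j. ?f (idx j)"])
    show "(\<lambda>j. ?f (idx j)) \<longlonglongrightarrow> 0"
      using LIMSEQ_subseq_LIMSEQ[OF summable_LIMSEQ_zero[OF that] mono] by (simp add: o_def)
    have "dist_nearest_int (x j * \<theta>) \<le> (\<Sum>a\<in>Y (idx j). dist_nearest_int (real a * \<theta>))" for j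
      using xY Y[OF idx(1)[of j]] finite_subset[of "Y (idx j)" "octave (idx j)"]
      by (intro member_le_sum) (auto simp: dist_nearest_int_nonneg)
    then show "\<forall>\<^sub>F j in sequentially. dist_nearest_int (x j * \<theta>) \<le> ?f (idx j)"
      by (simp add: idx)
  qed (auto simp: dist_nearest_int_nonneg)
  show ?thesis
    by (rule countable_subset[OF _ countable_limit]) (intro Collect_mono impI tends)
qed

section \<open>Keeping a divergent remainder\<close>

text \<open>
  The natural numbers are cut into consecutive intervals. Each series owns infinitely many of
  them, and an interval ends as soon as its owner has gained at least 1 on it.
\<close>

lemma assign_indices:
  fixes s :: "nat \<Rightarrow> nat \<Rightarrow> real"
  assumes nonneg: "\<And>i k. s i k \<ge> 0" and div: "\<And>i. \<not> summable (s i)"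
  obtains \<iota> :: "nat \<Rightarrow> nat" where "\<And>i. \<not> summable (\<lambda>k. if \<iota> k = i then s i k else 0)"
proof -
  have reach: "\<exists>n'>n. (\<Sum>k\<in>{n..<n'}. s i k) \<ge> 1" for i n
  proof (rule ccontr)
    assume "\<not> (\<exists>n'>n. (\<Sum>k\<in>{n..<n'}. s i k) \<ge> 1)"
    then have less: "(\<Sum>k\<in>{n..<n'}. s i k) < 1" if "n' > n" for n'
      using that by force
    have "(\<Sum>k<m. s i (k + n)) \<le> 1" for m
    proof (cases "m = 0")
      case False
      have "(\<Sum>k<m. s i (k + n)) = (\<Sum>k\<in>{n..<m + n}. s i k)"
        using sum.shift_bounds_nat_ivl[of "s i" 0 n m] by (simp add: atLeast0LessThan)
      then show ?thesis using less[of "m + n"] False by simp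
    qed simp
    then have "summable (\<lambda>k. s i (k + n))"
      using nonneg by (intro summableI_nonneg_bounded[of _ 1]) auto
    then show False using div[of i] by (simp add: summable_iff_shift)
  qed
  \<comment> \<open>Each natural number is the first component of infinitely many decoded pairs.\<close>
  define task where "task j = fst (prod_decode j)" for j
  define N where "N = rec_nat 0 (\<lambda>j n. SOME n'. n' > n \<and> (\<Sum>k\<in>{n..<n'}. s (task j) k) \<ge> 1)"
  have N: "N (Suc j) > N j" "(\<Sum>k\<in>{N j..<N (Suc j)}. s (task j) k) \<ge> 1" for j
    using someI_ex[OF reach[of "N j" "task j"]] by (simp_all add: N_def)
  have mono: "strict_mono N" using N(1) by (simp add: strict_mono_Suc_iff)
  define \<iota> where "\<iota> k = task (THE j. N j \<le> k \<and> k < N (Suc j))" for k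
  have \<iota>: "\<iota> k = task j" if "N j \<le> k" "k < N (Suc j)" for j k
  proof -
    have "j' = j" if "N j' \<le> k" "k < N (Suc j')" for j'
    proof -
      have "N j' < N (Suc j)" "N j < N (Suc j')" using that \<open>N j \<le> k\<close> \<open>k < N (Suc j)\<close> by linarith+
      then show ?thesis using mono by (simp add: strict_mono_less)
    qed
    then have "(THE j. N j \<le> k \<and> k < N (Suc j)) = j" using that by blast
    then show ?thesis by (simp add: \<iota>_def)
  qed
  have "\<not> summable (\<lambda>k. if \<iota> k = i then s i k else 0)" (is "\<not> summable ?f") for i
  proof
    assume "summable ?f"
    then have "\<exists>M. \<forall>m\<ge>M. \<forall>n. norm (sum ?f {m..<n}) < 1"
      unfolding summable_Cauchy by (meson zero_less_one)
    then obtain M where M: "\<And>m n. m \<ge> M \<Longrightarrow> norm (sum ?f {m..<n}) < 1" by blast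
    \<comment> \<open>The interval with this number belongs to the series \<open>i\<close> and starts beyond \<open>M\<close>.\<close>
    define j where "j = prod_encode (i, M)"
    have "task j = i" by (simp add: task_def j_def)
    have "M \<le> j" unfolding j_def by (rule le_prod_encode_2)
    also have "j \<le> N j" using mono by (rule strict_mono_imp_increasing)
    finally have "norm (sum ?f {N j..<N (Suc j)}) < 1" by (rule M)
    moreover have "sum ?f {N j..<N (Suc j)} = (\<Sum>k\<in>{N j..<N (Suc j)}. s i k)"
      using \<iota>[of j] \<open>task j = i\<close> by (intro sum.cong) auto
    ultimately show False using N(2)[of j] \<open>task j = i\<close> by simp
  qed
  then show thesis using that by blast
qed

text \<open>
  If the removed elements avoid one of maximal weight, they weigh at most four times as much
  as what stays.
\<close>

lemma remove_four:
  fixes w :: "nat \<Rightarrow> real"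
  assumes "card Y \<ge> 5" and nonneg: "\<And>a. w a \<ge> 0"
  shows "\<exists>R\<subseteq>Y. card R = 4 \<and> (\<Sum>a\<in>Y. w a) \<le> 5 * (\<Sum>a\<in>Y - R. w a)"
proof -
  have fin: "finite Y" "Y \<noteq> {}" using assms(1) by (auto intro: card_ge_0_finite)
  then have "Max (w ` Y) \<in> w ` Y" by simp
  then obtain x where "x \<in> Y" "w x = Max (w ` Y)" by force
  then have x: "x \<in> Y" "\<And>a. a \<in> Y \<Longrightarrow> w a \<le> w x" using fin by auto
  have "card (Y - {x}) \<ge> 4" using assms(1) x(1) by simp
  then obtain R where R: "R \<subseteq> Y - {x}" "card R = 4"
    by (meson obtain_subset_with_card_n)
  have "(\<Sum>a\<in>R. w a) \<le> 4 * w x"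
    using sum_bounded_above[of R w "w x"] R x(2) by auto
  moreover have "w x \<le> (\<Sum>a\<in>Y - R. w a)"
    using R x(1) fin nonneg by (intro member_le_sum) auto
  moreover have "(\<Sum>a\<in>Y. w a) = (\<Sum>a\<in>Y - R. w a) + (\<Sum>a\<in>R. w a)"
    using R fin by (intro sum.subset_diff) auto
  ultimately show ?thesis using R by (intro exI[of _ R]) auto
qed

text \<open>
  Four elements can be taken out of every octave without destroying divergence, at countably
  many frequencies at once: each octave serves a single frequency, and its removed elements
  are chosen with respect to that frequency. This is what five elements per octave are for.
\<close>

lemma select_divergent:
  fixes Y :: "nat \<Rightarrow> nat set" and P :: "nat \<Rightarrow> bool" and \<Theta> :: "real set"
  assumes five: "\<And>k. P k \<Longrightarrow> card (Y k) \<ge> 5" and "countable \<Theta>"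
    and div: "\<And>\<theta>. \<theta> \<in> \<Theta> \<Longrightarrow> \<not> summable (\<lambda>k. if P k then \<Sum>a\<in>Y k. dist_nearest_int (real a * \<theta>) else 0)"
  obtains R where "\<And>k. P k \<Longrightarrow> R k \<subseteq> Y k \<and> card (R k) = 4"
    "\<And>\<theta>. \<theta> \<in> \<Theta> \<Longrightarrow> \<not> summable (\<lambda>k. if P k then \<Sum>a\<in>Y k - R k. dist_nearest_int (real a * \<theta>) else 0)"
proof (cases "\<Theta> = {}")
  case True
  have "\<exists>R. P k \<longrightarrow> R \<subseteq> Y k \<and> card R = 4" for k
    using five[of k] remove_four[of "Y k" "\<lambda>_. 0"] by auto
  then show thesis using that True by (metis empty_iff)
next
  case False
  define t where "t = from_nat_into \<Theta>"
  have t: "range t = \<Theta>" unfolding t_def using False assms(2) by (rule range_from_nat_into)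
  define s where "s i k = (if P k then \<Sum>a\<in>Y k. dist_nearest_int (real a * t i) else 0)" for i k
  have "s i k \<ge> 0" "\<not> summable (s i)" for i k
    using div[of "t i"] t unfolding s_def by (auto intro!: sum_nonneg dist_nearest_int_nonneg)
  then obtain \<iota> where \<iota>: "\<And>i. \<not> summable (\<lambda>k. if \<iota> k = i then s i k else 0)"
    using assign_indices[of s] by blast
  \<comment> \<open>The octave \<open>k\<close> serves the frequency \<open>t (\<iota> k)\<close>.\<close>
  have "\<exists>R. P k \<longrightarrow> R \<subseteq> Y k \<and> card R = 4 \<and>
          s (\<iota> k) k \<le> 5 * (\<Sum>a\<in>Y k - R. dist_nearest_int (real a * t (\<iota> k)))" for k
    using five[of k] remove_four[of "Y k" "\<lambda>a. dist_nearest_int (real a * t (\<iota> k))"]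
      dist_nearest_int_nonneg unfolding s_def by simp
  then obtain R where R: "\<And>k. P k \<Longrightarrow> R k \<subseteq> Y k \<and> card (R k) = 4 \<and>
          s (\<iota> k) k \<le> 5 * (\<Sum>a\<in>Y k - R k. dist_nearest_int (real a * t (\<iota> k)))"
    by metis
  have "\<not> summable (\<lambda>k. if P k then \<Sum>a\<in>Y k - R k. dist_nearest_int (real a * \<theta>) else 0)"
    (is "\<not> summable ?g") if \<theta>: "\<theta> \<in> \<Theta>" for \<theta>
  proof
    assume g: "summable ?g"
    from \<theta> t obtain i where i: "\<theta> = t i" by auto
    have "summable (\<lambda>k. if \<iota> k = i then s i k else 0)"
    proof (rule summable_comparison_test')
      show "summable (\<lambda>k. 5 * ?g k)" using g by (rule summable_mult)
      show "norm (if \<iota> k = i then s i k else 0) \<le> 5 * ?g k" if "k \<ge> 0" for k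
      proof -
        have "s i k \<ge> 0" "?g k \<ge> 0"
          unfolding s_def by (auto intro!: sum_nonneg dist_nearest_int_nonneg)
        then have "\<bar>s i k\<bar> = s i k" "?g k \<ge> 0" by simp_all
        then show ?thesis using R[of k] i by (cases "P k") (auto simp: s_def)
      qed
    qed
    then show False using \<iota> by blast
  qed
  then show thesis using that[of R] R by simp
qed

text \<open>
  The frequencies at which the remainder converges form a countable set, but this set depends
  on the remainder, so one cannot simply serve all of them. Splitting by the parity of the
  octave removes the circularity. The frequencies at which the odd octaves of \<open>A\<close> converge form
  a countable set that is known beforehand; at these the even octaves of \<open>A\<close> diverge, and the
  choice in the even octaves keeps it so. After that choice the frequencies at which the even
  part of the remainder converges are again a known countable set, and the choice in the odd
  octaves serves those of them at which the odd octaves of \<open>A\<close> diverge. No other non-integral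
  frequency is left over.
\<close>

lemma divergent_remainder:
  fixes A :: "nat set"
  assumes five: "\<And>k. k \<ge> k0 \<Longrightarrow> card (A \<inter> octave k) \<ge> 5"
    and div: "\<And>\<theta>::real. \<theta> \<notin> \<int> \<Longrightarrow>
      \<not> summable (\<lambda>k. if k \<ge> k0 then \<Sum>a\<in>A \<inter> octave k. dist_nearest_int (real a * \<theta>) else 0)"
  obtains R where "\<And>k. k \<ge> k0 \<Longrightarrow> R k \<subseteq> A \<inter> octave k \<and> card (R k) = 4"
    "\<And>\<theta>::real. \<theta> \<notin> \<int> \<Longrightarrow>
      \<not> summable (\<lambda>k. if k \<ge> k0 then \<Sum>a\<in>A \<inter> octave k - R k. dist_nearest_int (real a * \<theta>) else 0)"
proof -
  define s where "s Y \<theta> c = (\<lambda>k. if k \<ge> k0 \<and> even k = c then \<Sum>a\<in>Y k. dist_nearest_int (real a * \<theta>) else 0)"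
    for Y :: "nat \<Rightarrow> nat set" and \<theta> :: real and c
  have s_nonneg: "s Y \<theta> c k \<ge> 0" for Y \<theta> c k
    unfolding s_def by (auto intro!: sum_nonneg dist_nearest_int_nonneg)
  have s_split: "(if k \<ge> k0 then \<Sum>a\<in>Y k. dist_nearest_int (real a * \<theta>) else 0) = s Y \<theta> True k + s Y \<theta> False k"
    for Y \<theta> k by (simp add: s_def)
  let ?A = "\<lambda>k. A \<inter> octave k"
  have one_parity: "\<not> summable (s ?A \<theta> True)" if "\<theta> \<notin> \<int>" "summable (s ?A \<theta> False)" for \<theta>
    using div[OF that(1)] summable_add[of "s ?A \<theta> True" "s ?A \<theta> False"] that(2)
    unfolding s_split[where Y = ?A] by blast
  have select: "\<exists>R. (\<forall>k. k \<ge> k0 \<and> even k = c \<longrightarrow> R k \<subseteq> ?A k \<and> card (R k) = 4) \<and>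
                 (\<forall>\<theta>\<in>\<Theta>. \<not> summable (s (\<lambda>k. ?A k - R k) \<theta> c))"
    if "countable \<Theta>" "\<And>\<theta>. \<theta> \<in> \<Theta> \<Longrightarrow> \<not> summable (s ?A \<theta> c)" for \<Theta> c
  proof (rule select_divergent[of "\<lambda>k. k \<ge> k0 \<and> even k = c" ?A \<Theta>])
    show "\<not> summable (\<lambda>k. if k \<ge> k0 \<and> even k = c
            then \<Sum>a\<in>?A k. dist_nearest_int (real a * \<theta>) else 0)" if "\<theta> \<in> \<Theta>" for \<theta>
      using \<open>\<And>\<theta>. \<theta> \<in> \<Theta> \<Longrightarrow> \<not> summable (s ?A \<theta> c)\<close>[OF that] unfolding s_def .
    fix R
    assume "\<And>k. k \<ge> k0 \<and> even k = c \<Longrightarrow> R k \<subseteq> ?A k \<and> card (R k) = 4"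
      "\<And>\<theta>. \<theta> \<in> \<Theta> \<Longrightarrow> \<not> summable (\<lambda>k. if k \<ge> k0 \<and> even k = c
            then \<Sum>a\<in>?A k - R k. dist_nearest_int (real a * \<theta>) else 0)"
    then show ?thesis by (intro exI[of _ R]) (unfold s_def, blast)
  qed (use five that in auto)
  define \<Theta>1 where "\<Theta>1 = {\<theta>. \<theta> \<notin> \<int> \<and> summable (s ?A \<theta> False)}"
  have ne: "?A k - Z \<noteq> {}" if "k \<ge> k0" "Z \<subseteq> ?A k" "card Z = 4" for Z k
  proof
    assume "?A k - Z = {}"
    then have "Z = ?A k" using that(2) by blast
    then show False using five[OF that(1)] that(3) by simp
  qed
  have c1: "countable \<Theta>1"
  proof (rule countable_subset)
    show "countable {\<theta>. summable (s ?A \<theta> False)}"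
      unfolding s_def using five by (intro countable_summable_parity) fastforce
  qed (auto simp: \<Theta>1_def)
  have n1: "\<not> summable (s ?A \<theta> True)" if "\<theta> \<in> \<Theta>1" for \<theta>
    using that one_parity by (auto simp: \<Theta>1_def)
  obtain R1 where "(\<forall>k. k \<ge> k0 \<and> even k = True \<longrightarrow> R1 k \<subseteq> ?A k \<and> card (R1 k) = 4) \<and>
      (\<forall>\<theta>\<in>\<Theta>1. \<not> summable (s (\<lambda>k. ?A k - R1 k) \<theta> True))"
    using select[OF c1 n1] by (rule exE)
  note R1 = this[THEN conjunct1, rule_format] this[THEN conjunct2, rule_format]
  \<comment> \<open>In the even octaves the choice is now final; the odd ones are still untouched.\<close>
  define Y1 where "Y1 k = (if even k then ?A k - R1 k else ?A k)" for k
  have Y1: "s Y1 \<theta> True = s (\<lambda>k. ?A k - R1 k) \<theta> True" for \<theta>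
    by (auto simp: s_def Y1_def fun_eq_iff)
  define \<Theta>2 where "\<Theta>2 = {\<theta>. summable (s Y1 \<theta> True) \<and> \<not> summable (s ?A \<theta> False)}"
  have c2: "countable \<Theta>2"
  proof (rule countable_subset)
    show "countable {\<theta>. summable (s Y1 \<theta> True)}"
      unfolding s_def
    proof (rule countable_summable_parity)
      fix k assume k: "k \<ge> k0"
      show "Y1 k \<subseteq> octave k \<and> Y1 k \<noteq> {}"
      proof (cases "even k")
        case True
        then show ?thesis using ne[OF k] R1(1)[of k] k by (simp add: Y1_def) blast
      next
        case False
        then show ?thesis using five[OF k] by (auto simp: Y1_def)
      qed
    qed
  qed (auto simp: \<Theta>2_def)
  have n2: "\<not> summable (s ?A \<theta> False)" if "\<theta> \<in> \<Theta>2" for \<theta>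
    using that by (auto simp: \<Theta>2_def)
  obtain R2 where "(\<forall>k. k \<ge> k0 \<and> even k = False \<longrightarrow> R2 k \<subseteq> ?A k \<and> card (R2 k) = 4) \<and>
      (\<forall>\<theta>\<in>\<Theta>2. \<not> summable (s (\<lambda>k. ?A k - R2 k) \<theta> False))"
    using select[OF c2 n2] by (rule exE)
  note R2 = this[THEN conjunct1, rule_format] this[THEN conjunct2, rule_format]
  define R where "R k = (if even k then R1 k else R2 k)" for k
  let ?E = "\<lambda>k. ?A k - R k"
  have E: "s ?E \<theta> True = s Y1 \<theta> True" "s ?E \<theta> False = s (\<lambda>k. ?A k - R2 k) \<theta> False" for \<theta>
    by (auto simp: s_def Y1_def R_def fun_eq_iff)
  have div_E: "\<not> summable (\<lambda>k. s ?E \<theta> True k + s ?E \<theta> False k)" if "\<theta> \<notin> \<int>" for \<theta>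
  proof
    assume sm: "summable (\<lambda>k. s ?E \<theta> True k + s ?E \<theta> False k)"
    have summable_E: "summable (s ?E \<theta> c)" for c
      using s_nonneg by (cases c) (auto intro!: summable_comparison_test'[OF sm, of 0])
    have "summable (s Y1 \<theta> True)" "summable (s (\<lambda>k. ?A k - R2 k) \<theta> False)"
      using summable_E[of True] summable_E[of False] unfolding E by simp_all
    moreover from this have "\<theta> \<notin> \<Theta>1" using R1(2)[of \<theta>] unfolding Y1 by blast
    ultimately show False using R2(2)[of \<theta>] that unfolding \<Theta>1_def \<Theta>2_def by blast
  qed
  show thesis
  proof (rule that[of R])
    fix k assume "k \<ge> k0"
    then show "R k \<subseteq> ?A k \<and> card (R k) = 4"
      using R1(1)[of k] R2(1)[of k] by (cases "even k") (simp_all add: R_def)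
  next
    fix \<theta> :: real assume "\<theta> \<notin> \<int>"
    then show "\<not> summable (\<lambda>k. if k \<ge> k0 then \<Sum>a\<in>?A k - R k. dist_nearest_int (real a * \<theta>) else 0)"
      unfolding s_split[where Y = ?E] by (rule div_E)
  qed
qed

lemma not_summable_octaves:
  fixes A :: "nat set"
  assumes inf: "(\<Sum>\<^sub>\<infinity>a\<in>A. ennreal (dist_nearest_int (real a * \<theta>))) = \<infinity>"
  shows "\<not> summable (\<lambda>k. if k \<ge> k0 then \<Sum>a\<in>A \<inter> octave k. dist_nearest_int (real a * \<theta>) else 0)"
    (is "\<not> summable ?t")
proof
  assume sm: "summable ?t"
  have t_nonneg: "?t k \<ge> 0" for k by (auto intro!: sum_nonneg dist_nearest_int_nonneg)
  define c where "c = (\<Sum>a\<in>A \<inter> {..2 ^ k0}. dist_nearest_int (real a * \<theta>))"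
  have initial: "(\<Sum>a\<in>A \<inter> {..2 ^ K}. dist_nearest_int (real a * \<theta>)) \<le> c + (\<Sum>k<K. ?t k)" if "K \<ge> k0" for K
    using that
  proof (induction K rule: dec_induct)
    case base
    show ?case using sum_nonneg[of "{..<k0}" ?t] t_nonneg by (simp add: c_def)
  next
    case (step K)
    have "A \<inter> {..2 ^ Suc K} = A \<inter> {..2 ^ K} \<union> A \<inter> octave K" by auto
    then have "(\<Sum>a\<in>A \<inter> {..2 ^ Suc K}. dist_nearest_int (real a * \<theta>))
        = (\<Sum>a\<in>A \<inter> {..2 ^ K} \<union> A \<inter> octave K. dist_nearest_int (real a * \<theta>))"
      by (rule arg_cong)
    also have "\<dots> = (\<Sum>a\<in>A \<inter> {..2 ^ K}. dist_nearest_int (real a * \<theta>))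
          + (\<Sum>a\<in>A \<inter> octave K. dist_nearest_int (real a * \<theta>))"
      by (rule sum.union_disjoint) auto
    also have "(\<Sum>a\<in>A \<inter> octave K. dist_nearest_int (real a * \<theta>)) = ?t K"
      using step.hyps(1) by (simp only: if_True)
    finally show ?case using step.IH by (simp only: sum.lessThan_Suc)
  qed
  have bound: "sum (\<lambda>a. ennreal (dist_nearest_int (real a * \<theta>))) F \<le> ennreal (c + suminf ?t)"
    if F: "finite F" "F \<subseteq> A" for F
  proof -
    obtain n where n: "\<forall>a\<in>F. a \<le> n" using F(1) finite_nat_set_iff_bounded_le by blast
    have "n < 2 ^ n" by (rule less_exp)
    also have "(2::nat) ^ n \<le> 2 ^ max n k0" by (rule power_increasing) auto
    finally have "F \<subseteq> A \<inter> {..2 ^ max n k0}" using n F(2) by fastforce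
    then have "(\<Sum>a\<in>F. dist_nearest_int (real a * \<theta>)) \<le> (\<Sum>a\<in>A \<inter> {..2 ^ max n k0}. dist_nearest_int (real a * \<theta>))"
      by (intro sum_mono2) (auto simp: dist_nearest_int_nonneg)
    also have "\<dots> \<le> c + (\<Sum>k<max n k0. ?t k)" by (rule initial) simp
    also have "\<dots> \<le> c + suminf ?t"
      using sum_le_suminf[OF sm finite_lessThan t_nonneg] by (rule add_left_mono)
    finally show ?thesis
      by (simp add: sum_ennreal dist_nearest_int_nonneg ennreal_leI)
  qed
  have "(\<Sum>\<^sub>\<infinity>a\<in>A. ennreal (dist_nearest_int (real a * \<theta>))) \<le> ennreal (c + suminf ?t)"
    by (subst nonneg_infsum_complete) (auto intro!: SUP_least bound)
  then show False using inf by (simp add: top_unique)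
qed

section \<open>Finite blocks that turn all frequencies\<close>

text \<open>
  Half the squared distance of the unit complex numbers with arguments \<open>0\<close> and \<open>2\<pi>\<theta>a\<close>.
\<close>

definition chord :: "real \<Rightarrow> nat \<Rightarrow> real" where
  "chord \<theta> a = 1 - cos (2 * pi * \<theta> * real a)"

lemma chord_nonneg: "0 \<le> chord \<theta> a" and chord_le_2: "chord \<theta> a \<le> 2"
  using cos_ge_minus_one[of "2 * pi * \<theta> * real a"] by (simp_all add: chord_def)

lemma continuous_on_chord: "continuous_on S (\<lambda>\<theta>. chord \<theta> a)"
  unfolding chord_def by (intro continuous_intros)

lemma chord_integer:
  assumes "\<theta> \<in> \<int>"
  shows "chord \<theta> a = 0"
proof -
  from assms obtain q where "\<theta> = of_int q" by (auto elim: Ints_cases)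
  then have "2 * pi * \<theta> * real a = 2 * pi * of_int (q * int a)" by simp
  then have "cos (2 * pi * \<theta> * real a) = 1" by (metis cos_int_2pin)
  then show ?thesis by (simp add: chord_def)
qed

text \<open>
  Half of the value that the chord takes at distance \<open>1/20\<close> from the integers. The factor one
  half makes room for the strict inequality that turns the covering sets of
  \<open>two_families\<close> into open sets.
\<close>

definition kappa :: real where "kappa = (1 - cos (pi / 10)) / 2"

lemma kappa_bounds: "0 < kappa" "kappa < 1"
proof -
  have "cos (pi / 10) < cos 0" by (rule cos_monotone_0_pi) (use pi_gt_zero in auto)
  then show "0 < kappa" by (simp add: kappa_def)
  have "cos (pi / 10) > 0" by (rule cos_gt_zero) (use pi_gt_zero in auto)
  then show "kappa < 1" by (simp add: kappa_def)
qed

lemma chord_gt_kappa: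
  assumes "dist_nearest_int (real a * \<theta>) \<ge> 1 / 20"
  shows "chord \<theta> a > kappa"
proof -
  define r where "r = real a * \<theta> - of_int (round (real a * \<theta>))"
  have r: "\<bar>r\<bar> \<ge> 1 / 20" "\<bar>r\<bar> \<le> 1 / 2"
    using assms dist_nearest_int_le_half[of "real a * \<theta>"] by (simp_all add: r_def dist_nearest_int_def)
  have "2 * pi * \<theta> * real a = 2 * pi * r + 2 * pi * of_int (round (real a * \<theta>))"
    by (simp add: r_def algebra_simps)
  then have "cos (2 * pi * \<theta> * real a) = cos (2 * pi * r)"
    by (simp add: cos_add sin_times_pi_eq_0)
  also have "\<dots> = cos (2 * pi * \<bar>r\<bar>)" by (simp add: abs_if)
  also have "\<dots> \<le> cos (pi / 10)"
  proof (rule cos_monotone_0_pi_le)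
    have "2 * pi * (1 / 20) \<le> 2 * pi * \<bar>r\<bar>" "2 * pi * \<bar>r\<bar> \<le> 2 * pi * (1 / 2)"
      using r by (intro mult_left_mono; simp)+
    then show "pi / 10 \<le> 2 * pi * \<bar>r\<bar>" "2 * pi * \<bar>r\<bar> \<le> pi" by simp_all
  qed (use pi_gt_zero in simp)
  finally show ?thesis using kappa_bounds(1) by (simp add: chord_def kappa_def)
qed

text \<open>
  Steps of length at most \<open>1/2\<close> cannot jump over the interval from \<open>1/4\<close> to \<open>3/4\<close>.
\<close>

lemma subset_sum_near_half:
  fixes v :: "nat \<Rightarrow> real"
  assumes "finite G" and "\<And>a. a \<in> G \<Longrightarrow> 0 \<le> v a \<and> v a \<le> 1 / 2" and "(\<Sum>a\<in>G. v a) \<ge> 1 / 4"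
  shows "\<exists>U\<subseteq>G. 1 / 4 \<le> (\<Sum>a\<in>U. v a) \<and> (\<Sum>a\<in>U. v a) \<le> 3 / 4"
  using assms
proof (induction G rule: finite_induct)
  case (insert a G)
  show ?case
  proof (cases "(\<Sum>a\<in>G. v a) \<ge> 1 / 4")
    case True
    then show ?thesis using insert.IH insert.prems by (meson insertCI subset_insertI2)
  next
    case False
    have "v a \<le> 1 / 2" using insert.prems(1) by blast
    then have "(\<Sum>a\<in>insert a G. v a) \<le> 3 / 4" using False insert.hyps by simp
    then show ?thesis using insert.prems(2) by blast
  qed
qed simp

text \<open>
  All the distances \<open>\<parallel>a\<theta>\<parallel>\<close> may be tiny, but the elements whose deviation from the nearest
  integer has a fixed sign accumulate, and for one of the two signs they account for half of
  the total. Replacing single elements by such blocks is why a divergent sum of the first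
  powers of \<open>\<parallel>a\<theta>\<parallel>\<close>, rather than of their squares, suffices.
\<close>

lemma block_turning_far:
  fixes \<theta> :: real
  assumes G: "finite G" "(\<Sum>a\<in>G. dist_nearest_int (real a * \<theta>)) \<ge> 1 / 2"
  shows "\<exists>U\<subseteq>G. cos (2 * pi * \<theta> * real (\<Sum>U)) \<le> 0"
proof -
  define r where "r a = real a * \<theta> - of_int (round (real a * \<theta>))" for a :: nat
  have r: "dist_nearest_int (real a * \<theta>) = \<bar>r a\<bar>" "\<bar>r a\<bar> \<le> 1 / 2" for a
    using dist_nearest_int_le_half[of "real a * \<theta>"] by (simp_all add: r_def dist_nearest_int_def)
  have "\<exists>\<sigma>\<in>{1, -1}. (\<Sum>a\<in>{a \<in> G. \<sigma> * r a \<ge> 0}. \<sigma> * r a) \<ge> 1 / 4"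
  proof (rule ccontr)
    assume "\<not> ?thesis"
    then have less: "(\<Sum>a\<in>{a \<in> G. r a \<ge> 0}. r a) < 1 / 4" "(\<Sum>a\<in>{a \<in> G. r a \<le> 0}. - r a) < 1 / 4"
      by auto
    have "(\<Sum>a\<in>G. \<bar>r a\<bar>) = (\<Sum>a\<in>{a \<in> G. r a \<ge> 0}. \<bar>r a\<bar>) + (\<Sum>a\<in>G - {a \<in> G. r a \<ge> 0}. \<bar>r a\<bar>)"
      using G(1) by (subst add.commute, intro sum.subset_diff) auto
    also have "(\<Sum>a\<in>G - {a \<in> G. r a \<ge> 0}. \<bar>r a\<bar>) \<le> (\<Sum>a\<in>{a \<in> G. r a \<le> 0}. \<bar>r a\<bar>)"
      using G(1) by (intro sum_mono2) auto
    finally show False using less G(2) by (simp add: r(1))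
  qed
  then obtain \<sigma> where \<sigma>: "\<sigma> \<in> {1, -1 :: real}" "(\<Sum>a\<in>{a \<in> G. \<sigma> * r a \<ge> 0}. \<sigma> * r a) \<ge> 1 / 4" by blast
  have le_half: "\<sigma> * r a \<le> 1 / 2" for a using r(2)[of a] \<sigma>(1) by auto
  have "\<exists>U\<subseteq>{a \<in> G. \<sigma> * r a \<ge> 0}. 1 / 4 \<le> (\<Sum>a\<in>U. \<sigma> * r a) \<and> (\<Sum>a\<in>U. \<sigma> * r a) \<le> 3 / 4"
  proof (rule subset_sum_near_half)
    show "finite {a \<in> G. \<sigma> * r a \<ge> 0}" using G(1) by simp
    show "0 \<le> \<sigma> * r a \<and> \<sigma> * r a \<le> 1 / 2" if "a \<in> {a \<in> G. \<sigma> * r a \<ge> 0}" for a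
      using that le_half[of a] by simp
    show "1 / 4 \<le> (\<Sum>a\<in>{a \<in> G. \<sigma> * r a \<ge> 0}. \<sigma> * r a)" by (rule \<sigma>(2))
  qed
  then obtain U where U: "U \<subseteq> {a \<in> G. \<sigma> * r a \<ge> 0}"
    "1 / 4 \<le> (\<Sum>a\<in>U. \<sigma> * r a)" "(\<Sum>a\<in>U. \<sigma> * r a) \<le> 3 / 4" by blast
  \<comment> \<open>Modulo 1, the sum of the block times \<open>\<theta>\<close> lies between \<open>1/4\<close> and \<open>3/4\<close>, up to sign.\<close>
  define q where "q = (\<Sum>a\<in>U. round (real a * \<theta>))"
  have "2 * pi * \<theta> * real (\<Sum>U) = 2 * pi * (\<Sum>a\<in>U. r a) + 2 * pi * of_int q"
    by (simp add: r_def q_def sum_subtractf sum_distrib_left sum_distrib_right algebra_simps)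
  then have "cos (2 * pi * \<theta> * real (\<Sum>U)) = cos (2 * pi * (\<Sum>a\<in>U. r a))"
    by (simp add: cos_add sin_times_pi_eq_0)
  also have "\<dots> = cos (2 * pi * (\<Sum>a\<in>U. \<sigma> * r a))"
    using \<sigma>(1) by (auto simp: sum_negf)
  also have "\<dots> = - cos (2 * pi * (\<Sum>a\<in>U. \<sigma> * r a) - pi)"
    by (simp add: cos_diff)
  also have "\<dots> \<le> 0"
  proof -
    have "2 * pi * (1 / 4) \<le> 2 * pi * (\<Sum>a\<in>U. \<sigma> * r a)" "2 * pi * (\<Sum>a\<in>U. \<sigma> * r a) \<le> 2 * pi * (3 / 4)"
      using U by (intro mult_left_mono; simp)+
    then have "cos (2 * pi * (\<Sum>a\<in>U. \<sigma> * r a) - pi) \<ge> 0" by (intro cos_ge_zero) linarith+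
    then show ?thesis by simp
  qed
  finally show ?thesis using U(1) by blast
qed

text \<open>
  The blocks can be made disjoint because the next one may be taken beyond all earlier ones.
  This works for finitely many frequencies only; disjointness is what \<open>family_average\<close> needs.
\<close>

lemma disjoint_blocks_for_finitely_many:
  fixes Q :: "real set"
  assumes block: "\<And>\<theta> m. \<theta> \<notin> \<int> \<Longrightarrow> \<exists>U. finite U \<and> U \<subseteq> E \<inter> {m<..} \<and> chord \<theta> (\<Sum>U) \<ge> 1"
    and "finite Q" "Q \<inter> \<int> = {}"
  shows "\<exists>\<F>. finite \<F> \<and> disjoint \<F> \<and> (\<forall>U\<in>\<F>. finite U \<and> U \<subseteq> E \<inter> {m<..}) \<and>
           (\<forall>\<theta>\<in>Q. \<exists>U\<in>\<F>. chord \<theta> (\<Sum>U) \<ge> 1)"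
  using assms(2,3)
proof (induction Q rule: finite_induct)
  case empty
  show ?case by (intro exI[of _ "{}"]) simp
next
  case (insert \<theta> Q)
  from insert.IH insert.prems obtain \<F> where \<F>: "finite \<F>" "disjoint \<F>"
    "\<forall>U\<in>\<F>. finite U \<and> U \<subseteq> E \<inter> {m<..}" "\<forall>\<theta>\<in>Q. \<exists>U\<in>\<F>. chord \<theta> (\<Sum>U) \<ge> 1" by auto
  have "finite (\<Union>\<F>)" using \<F>(1,3) by blast
  then obtain M where M: "\<forall>a\<in>\<Union>\<F>. a \<le> M" using finite_nat_set_iff_bounded_le by blast
  obtain V where V: "finite V" "V \<subseteq> E \<inter> {max m M<..}" "chord \<theta> (\<Sum>V) \<ge> 1"
    using block[of \<theta> "max m M"] insert.prems by auto
  have "V \<inter> U = {}" if "U \<in> \<F>" for U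
    using M V(2) that by fastforce
  then have "disjoint (insert V \<F>)"
    using \<F>(2) by (auto simp: disjoint_def)
  moreover have "V \<subseteq> E \<inter> {m<..}" using V(2) by auto
  ultimately show ?case
    using \<F> V by (intro exI[of _ "insert V \<F>"]) auto
qed

text \<open>
  A single element of \<open>E\<close> beyond \<open>m\<close> turns every frequency by more than \<open>kappa\<close> except for those
  that keep all late \<open>x\<^sub>j\<close> within \<open>1/20\<close> of the integers. Among the latter only finitely many lie
  in the unit interval, as \<open>theta_determined\<close> shows, and these are served by disjoint blocks,
  together with a neighbourhood. What remains is compact, so finitely many single elements
  serve it. Blocks and single elements may overlap, hence the two families.
\<close>

lemma two_families:
  fixes x :: "nat \<Rightarrow> nat" and E :: "nat set"
  assumes xE: "\<And>j. x j \<in> E" and ratio: "\<And>j. x (Suc j) \<le> 8 * x j"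
    and lim: "filterlim x at_top sequentially"
    and block: "\<And>\<theta> m. \<theta> \<notin> \<int> \<Longrightarrow> \<exists>U. finite U \<and> U \<subseteq> E \<inter> {m<..} \<and> chord \<theta> (\<Sum>U) \<ge> 1"
    and \<gamma>: "\<gamma> > 0"
  obtains \<F>1 \<F>2 where "finite \<F>1" "disjoint \<F>1" "finite \<F>2" "disjoint \<F>2"
    "\<And>U. U \<in> \<F>1 \<union> \<F>2 \<Longrightarrow> finite U \<and> U \<subseteq> E \<inter> {m<..}"
    "\<And>\<theta>. \<theta> \<in> {0..1} \<Longrightarrow> chord \<theta> 1 \<ge> \<gamma> \<Longrightarrow> \<exists>U\<in>\<F>1 \<union> \<F>2. chord \<theta> (\<Sum>U) > kappa"
proof -
  have "eventually (\<lambda>j. x j \<ge> Suc m) sequentially" using lim by (simp add: filterlim_at_top)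
  then obtain n where n: "\<And>j. j \<ge> n \<Longrightarrow> x j > m" by (auto simp: eventually_sequentially Suc_le_eq)
  define Q where "Q = {\<theta>::real. \<theta> \<in> {0..1} \<and> (\<forall>j. dist_nearest_int (x (j + n) * \<theta>) < 1 / 20)}"
  have "finite Q"
  proof (rule inj_on_finite)
    show "inj_on (\<lambda>\<theta>::real. round (x n * \<theta>)) Q"
    proof (rule inj_onI)
      fix s t :: real
      assume st: "s \<in> Q" "t \<in> Q" "round (x n * s) = round (x n * t)"
      show "s = t"
      proof (rule theta_determined[of "\<lambda>j. x (j + n)" s t])
        show "filterlim (\<lambda>j. x (j + n)) at_top sequentially"
          using filterlim_compose[OF lim filterlim_add_const_nat_at_top] .
      qed (use st ratio in \<open>auto simp: Q_def\<close>)
    qed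
    show "(\<lambda>\<theta>::real. round (x n * \<theta>)) ` Q \<subseteq> {0..int (x n)}"
    proof safe
      fix \<theta> :: real assume "\<theta> \<in> Q"
      then have "0 \<le> x n * \<theta>" "x n * \<theta> \<le> real (x n)" by (auto simp: Q_def mult_left_le)
      note this[THEN round_mono]
      then show "round (x n * \<theta>) \<in> {0..int (x n)}" by simp
    qed
  qed simp
  then obtain \<F>1 where \<F>1: "finite \<F>1" "disjoint \<F>1" "\<forall>U\<in>\<F>1. finite U \<and> U \<subseteq> E \<inter> {m<..}"
    "\<forall>\<theta>\<in>Q - \<int>. \<exists>U\<in>\<F>1. chord \<theta> (\<Sum>U) \<ge> 1"
    using disjoint_blocks_for_finitely_many[OF block, of "Q - \<int>" m] by auto
  \<comment> \<open>The frequencies that remain once those turned by the blocks are taken away.\<close>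
  define K where "K = {\<theta>\<in>{0..1}. chord \<theta> 1 \<ge> \<gamma>} - (\<Union>U\<in>\<F>1. {\<theta>. chord \<theta> (\<Sum>U) > kappa})"
  have "compact ({0..1} \<inter> {\<theta>. chord \<theta> 1 \<ge> \<gamma>} - (\<Union>U\<in>\<F>1. {\<theta>. chord \<theta> (\<Sum>U) > kappa}))"
    by (intro compact_diff compact_Int_closed compact_Icc open_UN ballI open_Collect_less
        closed_Collect_le continuous_on_chord continuous_on_const)
  then have K_compact: "compact K" by (simp add: K_def Int_def)
  have V_open: "open {\<theta>. chord \<theta> (x (j + n)) > kappa}" for j
    by (intro open_Collect_less continuous_on_chord continuous_on_const)
  have K_cover: "K \<subseteq> (\<Union>j. {\<theta>. chord \<theta> (x (j + n)) > kappa})"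
  proof
    fix \<theta> assume \<theta>: "\<theta> \<in> K"
    then have "\<theta> \<notin> \<int>" using \<gamma> by (auto simp: K_def chord_integer)
    have "\<theta> \<notin> Q"
    proof
      assume "\<theta> \<in> Q"
      then obtain U where "U \<in> \<F>1" "chord \<theta> (\<Sum>U) \<ge> 1" using \<F>1(4) \<open>\<theta> \<notin> \<int>\<close> by blast
      then show False using \<theta> kappa_bounds(2) by (force simp: K_def)
    qed
    then obtain j where "dist_nearest_int (x (j + n) * \<theta>) \<ge> 1 / 20"
      using \<theta> by (auto simp: Q_def K_def not_less)
    then show "\<theta> \<in> (\<Union>j. {\<theta>. chord \<theta> (x (j + n)) > kappa})" using chord_gt_kappa by blast
  qed
  obtain J where J: "finite J" "K \<subseteq> (\<Union>j\<in>J. {\<theta>. chord \<theta> (x (j + n)) > kappa})"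
    by (rule compactE_image[OF K_compact V_open K_cover])
  define \<F>2 where "\<F>2 = (\<lambda>j. {x (j + n)}) ` J"
  show thesis
  proof (rule that[of \<F>1 \<F>2])
    show "disjoint \<F>2" by (auto simp: \<F>2_def disjoint_def)
    show "finite U \<and> U \<subseteq> E \<inter> {m<..}" if "U \<in> \<F>1 \<union> \<F>2" for U
      using that \<F>1(3) xE n by (auto simp: \<F>2_def)
    show "\<exists>U\<in>\<F>1 \<union> \<F>2. chord \<theta> (\<Sum>U) > kappa" if "\<theta> \<in> {0..1}" "chord \<theta> 1 \<ge> \<gamma>" for \<theta>
    proof (cases "\<theta> \<in> K")
      case True
      then obtain j where "j \<in> J" "chord \<theta> (x (j + n)) > kappa" using J(2) by blast
      then show ?thesis by (intro bexI[of _ "{x (j + n)}"]) (auto simp: \<F>2_def)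
    next
      case False
      then show ?thesis using that by (auto simp: K_def)
    qed
  qed (use \<F>1 J in \<open>auto simp: \<F>2_def\<close>)
qed

section \<open>The spectrum of a finite set\<close>

text \<open>
  Orthogonality of the characters of the cyclic group of order \<open>N\<close>.
\<close>

lemma sum_cos_multiples:
  fixes k :: int and N :: nat
  assumes "N > 0"
  shows "(\<Sum>r<N. cos (2 * pi * real r * of_int k / real N)) = (if int N dvd k then real N else 0)"
proof -
  define z where "z = cis (2 * pi * of_int k / real N)"
  have pw: "z ^ r = cis (2 * pi * real r * of_int k / real N)" for r
  proof -
    have "z ^ r = cis (real r * (2 * pi * of_int k / real N))"
      unfolding z_def by (rule Complex.DeMoivre)
    also have "real r * (2 * pi * of_int k / real N) = 2 * pi * real r * of_int k / real N"
      by simp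
    finally show ?thesis .
  qed
  have S: "(\<Sum>r<N. cos (2 * pi * real r * of_int k / real N)) = Re (\<Sum>r<N. z ^ r)"
    by (simp add: pw)
  show ?thesis
  proof (cases "int N dvd k")
    case True
    then obtain q where "k = int N * q" by blast
    then have "2 * pi * of_int k / real N = 2 * pi * of_int q" using assms by simp
    then have "z = cis (2 * pi * of_int q)" unfolding z_def by (rule arg_cong)
    then have "z = 1" by (simp only: cis_multiple_2pi Ints_of_int)
    then show ?thesis using S True by simp
  next
    case False
    have "z \<noteq> 1"
    proof
      assume "z = 1"
      then have "cos (2 * pi * of_int k / real N) = 1" unfolding z_def
        by (metis cis.simps(1) one_complex.simps(1))
      then obtain q :: int where "2 * pi * of_int k / real N = of_int q * 2 * pi"
        using cos_one_2pi_int by blast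
      then have "real_of_int k = of_int (q * int N)" using assms by (simp add: field_simps)
      then have "k = q * int N" by linarith
      then show False using False by simp
    qed
    moreover have "z ^ N = 1"
    proof -
      have "2 * pi * real N * of_int k / real N = 2 * pi * of_int k" using assms by simp
      then have "z ^ N = cis (2 * pi * of_int k)" using pw[of N] by (simp only:)
      then show ?thesis by (simp only: cis_multiple_2pi Ints_of_int)
    qed
    ultimately show ?thesis using S False by (simp add: geometric_sum)
  qed
qed

text \<open>
  The weight \<open>w r\<close> is \<open>1/N\<close> times the squared modulus of the Fourier coefficient of \<open>X\<close> at the
  frequency \<open>r/N\<close>. The last identity is Parseval's formula for the difference of the indicators
  of \<open>X\<close> and of its translate by \<open>h\<close>; the bound on \<open>h\<close> keeps the translate from wrapping around
  modulo \<open>N\<close>.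
\<close>

lemma spectral_weights:
  fixes X :: "nat set"
  assumes X: "X \<subseteq> {x..<x + L}" and N: "L \<le> N" "0 < N"
  obtains w :: "nat \<Rightarrow> real" where "\<And>r. w r \<ge> 0" "(\<Sum>r<N. w r) = card X"
    "\<And>h. h + L \<le> N \<Longrightarrow>
       (\<Sum>r<N. w r * (1 - cos (2 * pi * (real r / real N) * real h))) = card ((+) h ` X - X)"
proof -
  define w :: "nat \<Rightarrow> real" where
    "w r = (\<Sum>a\<in>X. \<Sum>b\<in>X. cos (2 * pi * real r * of_int (int a - int b) / real N)) / N" for r
  have fin: "finite X" using X finite_subset by blast
  have nonneg: "w r \<ge> 0" for r
  proof -
    define u where "u a = 2 * pi * real r * real a / real N" for a
    have "cos (2 * pi * real r * of_int (int a - int b) / real N)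
        = cos (u a) * cos (u b) + sin (u a) * sin (u b)" for a b
      unfolding u_def cos_diff[symmetric] by (simp add: algebra_simps diff_divide_distrib)
    then have "w r = ((\<Sum>a\<in>X. cos (u a)) ^ 2 + (\<Sum>a\<in>X. sin (u a)) ^ 2) / N"
      by (simp add: w_def power2_eq_square sum_product sum.distrib)
    then show ?thesis by simp
  qed
  have corr: "(\<Sum>r<N. w r * cos (2 * pi * (real r / real N) * real h)) = card (X \<inter> (+) h ` X)"
    if h: "h + L \<le> N" for h
  proof -
    have prod: "cos (2 * pi * real r * of_int (int a - int b) / real N)
            * cos (2 * pi * (real r / real N) * real h)
        = (cos (2 * pi * real r * of_int (int a - int b + int h) / real N)
            + cos (2 * pi * real r * of_int (int a - int b - int h) / real N)) / 2" for r a b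
      unfolding cos_times_cos by (simp add: algebra_simps diff_divide_distrib add_divide_distrib)
    have ind: "(\<Sum>r<N. cos (2 * pi * real r * of_int (int a - int b) / real N)
            * cos (2 * pi * (real r / real N) * real h))
        = N / 2 * (of_bool (b = h + a) + of_bool (a = h + b))" if "a \<in> X" "b \<in> X" for a b
    proof -
      have "a \<in> {x..<x + L}" "b \<in> {x..<x + L}" using that X by blast+
      then have "a < b + L" "b < a + L" by auto
      moreover have "m = 0" if "int N dvd m" "\<bar>m\<bar> < int N" for m
        using that dvd_imp_le_int[of m "int N"] by fastforce
      moreover have "\<bar>int a - int b + int h\<bar> < int N" "\<bar>int a - int b - int h\<bar> < int N"
        using calculation(1,2) h by linarith+
      moreover have "int a - int b + int h = 0 \<longleftrightarrow> b = h + a" "int a - int b - int h = 0 \<longleftrightarrow> a = h + b"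
        by linarith+
      ultimately have "int N dvd (int a - int b + int h) \<longleftrightarrow> b = h + a"
        "int N dvd (int a - int b - int h) \<longleftrightarrow> a = h + b"
        by (metis dvd_0_right)+
      then show ?thesis
        unfolding prod sum_divide_distrib[symmetric] sum.distrib sum_cos_multiples[OF N(2)]
        by simp
    qed
    have count: "(\<Sum>a\<in>X. \<Sum>b\<in>X. of_bool (b = h + a)) = real (card (X \<inter> (+) h ` X))"
    proof -
      have "(\<Sum>a\<in>X. \<Sum>b\<in>X. of_bool (b = h + a)) = (\<Sum>a\<in>X. of_bool (h + a \<in> X) :: real)"
        using fin by (intro sum.cong) (auto simp: of_bool_def sum.delta)
      also have "\<dots> = card {a \<in> X. h + a \<in> X}"
        using fin by (simp add: of_bool_def sum.If_cases Int_def)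
      also have "card {a \<in> X. h + a \<in> X} = card ((+) h ` {a \<in> X. h + a \<in> X})"
        by (simp add: card_image)
      also have "(+) h ` {a \<in> X. h + a \<in> X} = X \<inter> (+) h ` X" by auto
      finally show ?thesis .
    qed
    have "(\<Sum>r<N. w r * cos (2 * pi * (real r / real N) * real h))
        = (\<Sum>a\<in>X. \<Sum>b\<in>X. \<Sum>r<N. cos (2 * pi * real r * of_int (int a - int b) / real N)
            * cos (2 * pi * (real r / real N) * real h)) / N"
      unfolding w_def sum_divide_distrib sum_distrib_right
      by (subst sum.swap, rule sum.cong[OF refl], subst sum.swap) simp
    also have "\<dots> = (\<Sum>a\<in>X. \<Sum>b\<in>X. N / 2 * (of_bool (b = h + a) + of_bool (a = h + b))) / N"
      by (intro arg_cong2[where f = "(/)"] sum.cong refl ind)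
    also have "\<dots> = ((\<Sum>a\<in>X. \<Sum>b\<in>X. of_bool (b = h + a)) + (\<Sum>a\<in>X. \<Sum>b\<in>X. of_bool (a = h + b))) / 2"
      unfolding sum_distrib_left[symmetric] sum.distrib using N(2) by simp
    also have "(\<Sum>a\<in>X. \<Sum>b\<in>X. of_bool (a = h + b)) = (\<Sum>a\<in>X. \<Sum>b\<in>X. of_bool (b = h + a) :: real)"
      by (rule sum.swap)
    finally show ?thesis using count by simp
  qed
  have total: "(\<Sum>r<N. w r) = card X" using corr[of 0] N(1) by simp
  have "(\<Sum>r<N. w r * (1 - cos (2 * pi * (real r / real N) * real h))) = card ((+) h ` X - X)"
    if h: "h + L \<le> N" for h
  proof -
    have "card ((+) h ` X - X) + card (X \<inter> (+) h ` X) = card ((+) h ` X)"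
      using card_Diff_subset_Int[of "(+) h ` X" X] card_mono[of "(+) h ` X" "(+) h ` X \<inter> X"] fin
      by (simp add: Int_commute)
    then have "real (card ((+) h ` X - X)) = card X - real (card (X \<inter> (+) h ` X))"
      by (simp add: card_image flip: of_nat_add)
    then show ?thesis
      unfolding right_diff_distrib sum_subtractf corr[OF h] by (simp add: total)
  qed
  then show thesis using that nonneg total by blast
qed

text \<open>
  The points of the circle that belong to \<open>a\<close> and \<open>b + a\<close> are as far apart as those of \<open>0\<close> and
  \<open>b\<close>, so they cannot both be close to the point of \<open>0\<close>.
\<close>

lemma chord_pair: "chord \<theta> b / 2 \<le> chord \<theta> a + chord \<theta> (b + a)"
proof -
  define u where "u = 2 * pi * \<theta> * real a"
  define v where "v = pi * \<theta> * real b"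
  define c where "c = \<bar>cos v\<bar>"
  have "cos u + cos (u + 2 * v) = 2 * cos (u + v) * cos v"
    using cos_plus_cos[of "u + 2 * v" u] by (simp add: add.commute add_divide_distrib)
  also have "\<dots> \<le> \<bar>2 * cos (u + v) * cos v\<bar>" by simp
  also have "\<dots> \<le> 2 * c"
    using mult_right_mono[of "\<bar>cos (u + v)\<bar>" 1 "\<bar>cos v\<bar>"] by (simp add: abs_mult c_def)
  finally have "chord \<theta> a + chord \<theta> (b + a) \<ge> 2 - 2 * c"
    by (simp add: chord_def u_def v_def algebra_simps)
  moreover have "chord \<theta> b = 2 * (1 - c\<^sup>2)"
    using cos_double_cos[of v] by (simp add: chord_def v_def c_def mult.assoc)
  moreover have "(1 - c) * (1 + c) \<le> (1 - c) * 2"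
    by (intro mult_left_mono) (auto simp: c_def)
  ultimately show ?thesis by (simp add: power2_eq_square algebra_simps)
qed

text \<open>
  Subfamilies are paired by adding or removing \<open>U\<close>. On average over all subfamilies a single
  block therefore acts with at least a quarter of its strength, however many other blocks
  there are; this uniformity is what makes one choice of constants possible later on.
\<close>

lemma family_average:
  assumes \<F>: "finite \<F>" "disjoint \<F>" "\<And>U. U \<in> \<F> \<Longrightarrow> finite U" and U: "U \<in> \<F>"
  shows "2 ^ card \<F> * (chord \<theta> (\<Sum>U) / 4) \<le> (\<Sum>J\<in>Pow \<F>. chord \<theta> (\<Sum>(\<Union>J)))"
proof -
  define G where "G = \<F> - {U}"
  have G: "\<F> = insert U G" "U \<notin> G" "finite G" using U \<F>(1) by (auto simp: G_def)
  have split: "\<Sum>(\<Union>(insert U J)) = \<Sum>U + \<Sum>(\<Union>J)" if "J \<subseteq> G" for J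
  proof -
    have "finite J" using that G(3) by (rule finite_subset)
    moreover have "finite V" if "V \<in> J" for V using \<F>(3) that \<open>J \<subseteq> G\<close> G(1) by blast
    ultimately have "finite (\<Union>J)" by (rule finite_Union)
    moreover have "U \<inter> V = {}" if "V \<in> J" for V
    proof -
      have "V \<in> \<F>" "V \<noteq> U" using that \<open>J \<subseteq> G\<close> G(1,2) by auto
      then show ?thesis using disjointD[OF \<F>(2) U] by simp
    qed
    then have "U \<inter> \<Union>J = {}" by blast
    ultimately show ?thesis using \<F>(3)[OF U] by (simp add: sum.union_disjoint)
  qed
  have "2 ^ card \<F> * (chord \<theta> (\<Sum>U) / 4) = (\<Sum>J\<in>Pow G. chord \<theta> (\<Sum>U) / 2)"
    using G by (simp add: card_Pow)
  also have "\<dots> \<le> (\<Sum>J\<in>Pow G. chord \<theta> (\<Sum>(\<Union>J)) + chord \<theta> (\<Sum>(\<Union>(insert U J))))"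
  proof (rule sum_mono)
    fix J assume "J \<in> Pow G"
    then show "chord \<theta> (\<Sum>U) / 2 \<le> chord \<theta> (\<Sum>(\<Union>J)) + chord \<theta> (\<Sum>(\<Union>(insert U J)))"
      unfolding split[OF PowD[OF \<open>J \<in> Pow G\<close>]] by (intro chord_pair)
  qed
  also have "\<dots> = (\<Sum>J\<in>Pow G. chord \<theta> (\<Sum>(\<Union>J))) + (\<Sum>J\<in>insert U ` Pow G. chord \<theta> (\<Sum>(\<Union>J)))"
  proof -
    have "inj_on (insert U) (Pow G)" using G(2) by (auto simp: inj_on_def)
    then show ?thesis by (simp add: sum.reindex sum.distrib del: Union_insert)
  qed
  also have "\<dots> = (\<Sum>J\<in>Pow \<F>. chord \<theta> (\<Sum>(\<Union>J)))"
    unfolding G(1) Pow_insert using G by (intro sum.union_disjoint[symmetric]) auto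
  finally show ?thesis .
qed

text \<open>
  If all sums of blocks of a family move a set only slightly, then the set has little spectral
  mass at the frequencies that some block of the family turns.
\<close>

lemma family_mass:
  fixes w t :: "nat \<Rightarrow> real"
  assumes \<F>: "finite \<F>" "disjoint \<F>" "\<And>U. U \<in> \<F> \<Longrightarrow> finite U"
    and w: "\<And>r. w r \<ge> 0"
    and W: "\<And>J. J \<subseteq> \<F> \<Longrightarrow> (\<Sum>r<N. w r * chord (t r) (\<Sum>(\<Union>J))) \<le> W"
  shows "(\<Sum>r\<in>{r. r < N \<and> (\<exists>U\<in>\<F>. chord (t r) (\<Sum>U) > kappa)}. w r) \<le> 4 * W / kappa"
proof -
  let ?R = "{r. r < N \<and> (\<exists>U\<in>\<F>. chord (t r) (\<Sum>U) > kappa)}"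
  have "(\<Sum>r\<in>?R. w r) * (2 ^ card \<F> * (kappa / 4)) = (\<Sum>r\<in>?R. w r * (2 ^ card \<F> * (kappa / 4)))"
    by (rule sum_distrib_right)
  also have "\<dots> \<le> (\<Sum>r\<in>?R. w r * (\<Sum>J\<in>Pow \<F>. chord (t r) (\<Sum>(\<Union>J))))"
  proof (intro sum_mono mult_left_mono w)
    fix r assume "r \<in> ?R"
    then obtain U where U: "U \<in> \<F>" "chord (t r) (\<Sum>U) > kappa" by blast
    have "2 ^ card \<F> * (kappa / 4) \<le> 2 ^ card \<F> * (chord (t r) (\<Sum>U) / 4)" using U(2) by simp
    also have "\<dots> \<le> (\<Sum>J\<in>Pow \<F>. chord (t r) (\<Sum>(\<Union>J)))" by (rule family_average[OF \<F> U(1)])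
    finally show "2 ^ card \<F> * (kappa / 4) \<le> (\<Sum>J\<in>Pow \<F>. chord (t r) (\<Sum>(\<Union>J)))" .
  qed
  also have "\<dots> \<le> (\<Sum>r<N. w r * (\<Sum>J\<in>Pow \<F>. chord (t r) (\<Sum>(\<Union>J))))"
    by (intro sum_mono2) (auto intro!: mult_nonneg_nonneg w sum_nonneg chord_nonneg)
  also have "\<dots> = (\<Sum>J\<in>Pow \<F>. \<Sum>r<N. w r * chord (t r) (\<Sum>(\<Union>J)))"
    unfolding sum_distrib_left by (rule sum.swap)
  also have "\<dots> \<le> (\<Sum>J\<in>Pow \<F>. W)" by (intro sum_mono W) auto
  also have "\<dots> = 2 ^ card \<F> * W" using \<F>(1) by (simp add: card_Pow)
  finally have "2 ^ card \<F> * ((\<Sum>r\<in>?R. w r) * (kappa / 4)) \<le> 2 ^ card \<F> * W"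
    by (simp only: mult_ac)
  then have "(\<Sum>r\<in>?R. w r) * (kappa / 4) \<le> W" by (subst (asm) mult_le_cancel_left_pos) simp_all
  then show ?thesis using kappa_bounds(1) by (simp add: field_simps)
qed

section \<open>Long runs from nearly maximal density\<close>

text \<open>
  Every element of \<open>X\<close> lies at most \<open>l\<close> below the end of its run of consecutive elements.
\<close>

lemma card_le_run_ends:
  fixes X :: "nat set"
  assumes "finite X" and no_run: "\<And>x. \<not> {x..<x + l} \<subseteq> X"
  shows "card X \<le> l * card ((+) 1 ` X - X)"
proof -
  let ?D = "(+) 1 ` X - X"
  have "X \<subseteq> (\<Union>e\<in>?D. {e - l..<e})"
  proof
    fix a assume a: "a \<in> X"
    define i where "i = (LEAST i. a + i \<notin> X)"
    obtain b where "b \<in> {a..<a + l}" "b \<notin> X" using no_run by blast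
    then have ex: "a + (b - a) \<notin> X" "b - a < l" by auto
    have i: "a + i \<notin> X" "i \<le> b - a"
      unfolding i_def 
      by (rule LeastI[where P = "\<lambda>i. a + i \<notin> X", OF ex(1)],
          rule Least_le[where P = "\<lambda>i. a + i \<notin> X", OF ex(1)])
    then have "i > 0" using a by (cases i) auto
    then have "a + (i - 1) \<in> X" using not_less_Least[of "i - 1" "\<lambda>i. a + i \<notin> X"] by (simp add: i_def)
    then have "a + i \<in> ?D" using i(1) \<open>i > 0\<close> by (intro DiffI image_eqI[of _ _ "a + (i - 1)"]) auto
    moreover have "a \<in> {a + i - l..<a + i}" using i ex(2) \<open>i > 0\<close> by auto
    ultimately show "a \<in> (\<Union>e\<in>?D. {e - l..<e})" by blast
  qed
  then have "card X \<le> card (\<Union>e\<in>?D. {e - l..<e})" using assms(1) by (intro card_mono) auto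
  also have "\<dots> \<le> (\<Sum>e\<in>?D. card {e - l..<e})" using assms(1) by (intro card_UN_le) auto
  also have "\<dots> \<le> (\<Sum>e\<in>?D. l)" by (intro sum_mono) auto
  finally show ?thesis by (simp add: mult.commute)
qed

text \<open>
  Upper Banach density at least \<open>c\<close>, stated for every single window length. Its failure at one
  length then bounds the density in all longer windows, and no limit is needed.
\<close>

definition dense_windows :: "nat set \<Rightarrow> real \<Rightarrow> bool" where
  "dense_windows T c \<longleftrightarrow> (\<forall>L. \<exists>x. c * real L \<le> real (card (T \<inter> {x..<x + L})))"

lemma not_dense_windows_bound:
  assumes "\<not> dense_windows T c" "c \<ge> 0"
  obtains L1 where "\<And>x L. real (card (T \<inter> {x..<x + L})) \<le> c * (real L + real L1)"
proof -
  obtain L1 where L1: "\<And>x. real (card (T \<inter> {x..<x + L1})) < c * real L1"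
    using assms(1) by (auto simp: dense_windows_def not_le)
  then have "L1 > 0" by (cases "L1 = 0") auto
  have "real (card (T \<inter> {x..<x + L})) \<le> c * (real L + real L1)" for x L
  proof (induction L arbitrary: x rule: less_induct)
    case (less L)
    show ?case
    proof (cases "L < L1")
      case True
      then have "card (T \<inter> {x..<x + L}) \<le> card (T \<inter> {x..<x + L1})" by (intro card_mono) auto
      then have "real (card (T \<inter> {x..<x + L})) \<le> c * real L1" using L1[of x] by linarith
      also have "\<dots> \<le> c * (real L + real L1)" using assms(2) by (intro mult_left_mono) auto
      finally show ?thesis .
    next
      case False
      have "T \<inter> {x..<x + L} = T \<inter> {x..<x + L1} \<union> T \<inter> {x + L1..<x + L1 + (L - L1)}" using False by auto
      then have "card (T \<inter> {x..<x + L}) \<le> card (T \<inter> {x..<x + L1}) + card (T \<inter> {x + L1..<x + L1 + (L - L1)})"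
        by (metis card_Un_le)
      moreover have "real (card (T \<inter> {x + L1..<x + L1 + (L - L1)})) \<le> c * (real (L - L1) + real L1)"
        using False \<open>L1 > 0\<close> by (intro less.IH) simp
      ultimately have "real (card (T \<inter> {x..<x + L})) \<le> c * real L1 + c * (real (L - L1) + real L1)"
        using L1[of x] by linarith
      then show ?thesis using False by (simp add: of_nat_diff algebra_simps)
    qed
  qed
  then show thesis by (rule that)
qed

text \<open>
  The translates of \<open>T\<close> by \<open>0, \<dots>, C - 1\<close> cover the natural numbers, so one of \<open>C\<close> shifted
  windows contains its fair share of \<open>T\<close>.
\<close>

lemma dense_windows_of_gap:
  assumes "C > 0" and gap: "\<And>n. \<exists>s\<in>T. s \<le> n \<and> n < s + C"
  shows "dense_windows T (1 / real C)"
  unfolding dense_windows_def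
proof
  fix L
  let ?w = "\<lambda>i. T \<inter> {C - i..<C - i + L}"
  show "\<exists>x. 1 / real C * real L \<le> real (card (T \<inter> {x..<x + L}))"
  proof (rule ccontr)
    assume "\<not> ?thesis"
    then have "real (card (?w i)) < real L / real C" for i by (auto simp: not_le)
    then have "(\<Sum>i<C. real (card (?w i))) < (\<Sum>i<C. real L / real C)"
      using assms(1) by (intro sum_strict_mono) (auto simp only: finite_lessThan lessThan_empty_iff)
    then have "(\<Sum>i<C. real (card (?w i))) < real L" using assms(1) by simp
    then have less: "(\<Sum>i<C. card (?w i)) < L" by (simp flip: of_nat_sum)
    have "{C..<C + L} \<subseteq> (\<Union>i<C. (+) i ` ?w i)"
    proof
      fix n assume n: "n \<in> {C..<C + L}"
      obtain s where s: "s \<in> T" "s \<le> n" "n < s + C" using gap by blast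
      then have "n = (n - s) + s" "n - s < C" by auto
      moreover have "s \<in> ?w (n - s)" using s n by auto
      ultimately show "n \<in> (\<Union>i<C. (+) i ` ?w i)" by blast
    qed
    then have "L \<le> card (\<Union>i<C. (+) i ` ?w i)"
      using card_mono[of "\<Union>i<C. (+) i ` ?w i" "{C..<C + L}"] by simp
    also have "\<dots> \<le> (\<Sum>i<C. card ((+) i ` ?w i))" by (rule card_UN_le) simp
    also have "\<dots> = (\<Sum>i<C. card (?w i))" by (simp add: card_image)
    finally show False using less by simp
  qed
qed

text \<open>
  Let \<open>d\<close> be the supremum of the densities of the subset sums of \<open>B \<union> F\<close> over the finite subsets
  \<open>F\<close> of \<open>E\<close>, and let \<open>T\<close> belong to some \<open>F\<close> for which it is almost attained. If \<open>V\<close> is a finite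
  subset of \<open>E\<close> beyond \<open>F\<close> and has sum \<open>h\<close>, then \<open>T\<close> and \<open>T + h\<close> consist of subset sums of
  \<open>B \<union> (F \<union> V)\<close>, whose density is at most \<open>d\<close> again. So \<open>T + h\<close> hardly leaves \<open>T\<close>. By
  \<open>family_mass\<close> the spectral mass of \<open>T\<close> in a long window sits near the frequency \<open>0\<close>; hence
  \<open>T + 1\<close> hardly leaves \<open>T\<close> either, that is, \<open>T\<close> has few ends of runs. As its density stays
  bounded below, some run is long.
\<close>

lemma subset_sums_contain_long_runs:
  assumes disj: "B \<inter> E = {}" and dense: "dense_windows (subset_sums B) \<delta>" and "\<delta> > 0"
    and fam: "\<And>\<gamma> m. \<gamma> > 0 \<Longrightarrow> \<exists>\<F>1 \<F>2. finite \<F>1 \<and> disjoint \<F>1 \<and> finite \<F>2 \<and> disjoint \<F>2 \<and>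
      (\<forall>U\<in>\<F>1 \<union> \<F>2. finite U \<and> U \<subseteq> E \<inter> {m<..}) \<and>
      (\<forall>\<theta>\<in>{0..1}. chord \<theta> 1 \<ge> \<gamma> \<longrightarrow> (\<exists>U\<in>\<F>1 \<union> \<F>2. chord \<theta> (\<Sum>U) > kappa))"
  shows "\<exists>x. {x..<x + l} \<subseteq> subset_sums (B \<union> E)"
proof (rule ccontr)
  assume no_run: "\<nexists>x. {x..<x + l} \<subseteq> subset_sums (B \<union> E)"
  then have "l > 0" by (cases "l = 0") auto
  define D where "D = {c. \<exists>F. finite F \<and> F \<subseteq> E \<and> dense_windows (subset_sums (B \<union> F)) c}"
  have D_le: "c \<le> 1" if "c \<in> D" for c
  proof -
    from that obtain F where "dense_windows (subset_sums (B \<union> F)) c" by (auto simp: D_def)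
    then obtain x where "c * real 1 \<le> real (card (subset_sums (B \<union> F) \<inter> {x..<x + 1}))"
      unfolding dense_windows_def by blast
    also have "card (subset_sums (B \<union> F) \<inter> {x..<x + 1}) \<le> card {x..<x + 1}" by (intro card_mono) auto
    finally show ?thesis by simp
  qed
  have D_bdd: "bdd_above D" using D_le by (auto simp: bdd_above_def)
  have "\<delta> \<in> D" unfolding D_def using dense by (auto intro!: exI[of _ "{}"])
  define d where "d = Sup D"
  have d: "\<delta> \<le> d" unfolding d_def by (rule cSup_upper[OF \<open>\<delta> \<in> D\<close> D_bdd])
  \<comment> \<open>With these constants the final bound on the number of run ends amounts to the fraction
    \<open>\<delta> / (4l)\<close> of the window, one half of it coming from \<open>\<gamma>\<close> and one from \<open>\<epsilon>\<close>. Neither depends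
    on \<open>F\<close> or on the families.\<close>
  define \<epsilon> where "\<epsilon> = \<delta> * kappa / (512 * real l)"
  define \<gamma> where "\<gamma> = \<delta> / (8 * real l)"
  have pos: "\<epsilon> > 0" "\<gamma> > 0" using \<open>\<delta> > 0\<close> \<open>l > 0\<close> kappa_bounds(1) by (auto simp: \<epsilon>_def \<gamma>_def)
  have "\<epsilon> \<le> \<delta> / 2"
  proof -
    have "\<delta> * kappa \<le> \<delta> * (256 * real l)"
      using \<open>\<delta> > 0\<close> \<open>l > 0\<close> kappa_bounds(2) by (intro mult_left_mono) auto
    then show ?thesis using \<open>l > 0\<close> by (simp add: \<epsilon>_def field_simps)
  qed
  obtain c where "c \<in> D" "d - \<epsilon> < c"
    using less_cSup_iff[of D "d - \<epsilon>"] \<open>\<delta> \<in> D\<close> D_bdd pos(1) unfolding d_def by auto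
  then obtain F where F: "finite F" "F \<subseteq> E" and T_dense: "dense_windows (subset_sums (B \<union> F)) c"
    by (auto simp: D_def)
  define T where "T = subset_sums (B \<union> F)"
  obtain m where m: "\<forall>a\<in>F. a \<le> m" using F(1) finite_nat_set_iff_bounded_le by blast
  obtain \<F>1 \<F>2 where \<F>: "finite \<F>1" "disjoint \<F>1" "finite \<F>2" "disjoint \<F>2"
    and \<F>E: "\<And>U. U \<in> \<F>1 \<union> \<F>2 \<Longrightarrow> finite U \<and> U \<subseteq> E \<inter> {m<..}"
    and cover: "\<And>\<theta>. \<theta> \<in> {0..1} \<Longrightarrow> chord \<theta> 1 \<ge> \<gamma> \<Longrightarrow> \<exists>U\<in>\<F>1 \<union> \<F>2. chord \<theta> (\<Sum>U) > kappa"
    using fam[OF pos(2), of m] by (elim exE conjE) blast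
  define H where "H = Union ` (Pow \<F>1 \<union> Pow \<F>2)"
  have "finite H" using \<F>(1,3) by (simp add: H_def)
  have H: "finite V \<and> V \<subseteq> E \<inter> {m<..}" if "V \<in> H" for V
  proof -
    from that obtain J where J: "V = \<Union>J" "J \<subseteq> \<F>1 \<or> J \<subseteq> \<F>2" by (auto simp: H_def)
    then have "finite J" using \<F> finite_subset by blast
    then show ?thesis using J \<F>E by blast
  qed
  have "\<exists>L1. \<forall>x L. real (card (subset_sums (B \<union> (F \<union> V)) \<inter> {x..<x + L})) \<le> (d + \<epsilon>) * (real L + real L1)"
    if V: "V \<in> H" for V
  proof -
    have "\<not> dense_windows (subset_sums (B \<union> (F \<union> V))) (d + \<epsilon>)"
    proof
      assume "dense_windows (subset_sums (B \<union> (F \<union> V))) (d + \<epsilon>)"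
      then have "d + \<epsilon> \<in> D" unfolding D_def using H[OF V] F by blast
      then have "d + \<epsilon> \<le> d" unfolding d_def using D_bdd by (rule cSup_upper)
      then show False using pos(1) by simp
    qed
    moreover have "d + \<epsilon> \<ge> 0" using d \<open>\<delta> > 0\<close> pos(1) by simp
    ultimately obtain L1 where "\<And>x L. real (card (subset_sums (B \<union> (F \<union> V)) \<inter> {x..<x + L})) \<le> (d + \<epsilon>) * (real L + real L1)"
      by (rule not_dense_windows_bound) blast
    then show ?thesis by blast
  qed
  then obtain L1 where L1: "\<And>V x L. V \<in> H \<Longrightarrow>
      real (card (subset_sums (B \<union> (F \<union> V)) \<inter> {x..<x + L})) \<le> (d + \<epsilon>) * (real L + real (L1 V))"
    by metis
  define Lmax where "Lmax = (\<Sum>V\<in>H. L1 V)"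
  define hmax where "hmax = (\<Sum>V\<in>H. \<Sum>V)"
  have le_max: "L1 V \<le> Lmax" "\<Sum>V \<le> hmax" if "V \<in> H" for V
    unfolding Lmax_def hmax_def using that \<open>finite H\<close> by (auto intro: member_le_sum)
  \<comment> \<open>The window has to be so long that the translations, and the lengths from which on the
    density bounds hold, are negligible.\<close>
  obtain L :: nat where "real L > ((d + \<epsilon>) * real Lmax + real hmax) / \<epsilon>" using reals_Archimedean2 by blast
  then have L_big: "(d + \<epsilon>) * real Lmax + real hmax < \<epsilon> * real L" using pos(1) by (simp add: field_simps)
  have de: "(d + \<epsilon>) * real Lmax \<ge> 0" using d \<open>\<delta> > 0\<close> pos(1) by (intro mult_nonneg_nonneg) auto
  have "L > 0" using L_big de by (cases "L = 0") auto
  obtain x where x: "c * real L \<le> real (card (T \<inter> {x..<x + L}))"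
    using T_dense unfolding dense_windows_def T_def by blast
  define X where "X = T \<inter> {x..<x + L}"
  have X: "finite X" "X \<subseteq> {x..<x + L}" "X \<subseteq> T" by (auto simp: X_def)
  have "(d - \<epsilon>) * real L \<le> c * real L" using \<open>d - \<epsilon> < c\<close> by (intro mult_right_mono) auto
  then have card_X: "(d - \<epsilon>) * real L \<le> real (card X)" using x by (simp add: X_def)
  have card_X_le: "real (card X) \<le> real L"
    using card_mono[OF _ X(2)] by simp
  \<comment> \<open>The translate gains at most \<open>2\<epsilon>L\<close> elements inside the window by the choice of \<open>d\<close>; the rest
    of \<open>W\<close> pays for the length of the window being finite.\<close>
  define W where "W = 4 * \<epsilon> * real L"
  have shift: "real (card ((+) (\<Sum>V) ` X - X)) \<le> W" if V: "V \<in> H" for V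
  proof -
    define h where "h = \<Sum>V"
    define Y where "Y = ((+) h ` X - X) \<inter> {x..<x + L}"
    have "V \<inter> (B \<union> F) = {}" using H[OF V] m disj by fastforce
    moreover have "h \<in> subset_sums V" using H[OF V] by (auto simp: subset_sums_def h_def)
    ultimately have "(+) h ` T \<subseteq> subset_sums (V \<union> (B \<union> F))"
      unfolding T_def by (auto intro: subset_sums_add)
    moreover have "V \<union> (B \<union> F) = B \<union> (F \<union> V)" by blast
    ultimately have shifted: "(+) h ` T \<subseteq> subset_sums (B \<union> (F \<union> V))" by simp
    have unshifted: "T \<subseteq> subset_sums (B \<union> (F \<union> V))" unfolding T_def by (rule subset_sums_mono) blast
    have "Y \<subseteq> (+) h ` T"
      unfolding Y_def by (rule order_trans[OF _ image_mono[OF X(3)]]) blast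
    then have "Y \<subseteq> subset_sums (B \<union> (F \<union> V))" using shifted by (rule order_trans)
    moreover have "Y \<subseteq> {x..<x + L}" unfolding Y_def by blast
    moreover have "X \<subseteq> subset_sums (B \<union> (F \<union> V))" using X(3) unshifted by (rule order_trans)
    ultimately have "Y \<union> X \<subseteq> subset_sums (B \<union> (F \<union> V)) \<inter> {x..<x + L}"
      using X(2) by (intro Un_least Int_greatest)
    then have "card (Y \<union> X) \<le> card (subset_sums (B \<union> (F \<union> V)) \<inter> {x..<x + L})"
      by (intro card_mono) auto
    moreover have "card (Y \<union> X) = card Y + card X"
      using X(1) by (intro card_Un_disjoint) (auto simp: Y_def)
    ultimately have "real (card Y) + real (card X) \<le> (d + \<epsilon>) * (real L + real (L1 V))"
      using L1[OF V, of x L] by linarith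
    moreover have "(d + \<epsilon>) * real (L1 V) \<le> (d + \<epsilon>) * real Lmax"
      using le_max(1)[OF V] d \<open>\<delta> > 0\<close> pos(1) by (intro mult_left_mono) auto
    ultimately have Y: "real (card Y) \<le> 2 * \<epsilon> * real L + (d + \<epsilon>) * real Lmax"
      using card_X by (simp add: algebra_simps)
    have "(+) h ` X - X \<subseteq> Y \<union> {x + L..<x + L + h}" using X(2) by (auto simp: Y_def)
    then have "card ((+) h ` X - X) \<le> card (Y \<union> {x + L..<x + L + h})"
      using X(1) by (intro card_mono) (auto simp: Y_def)
    also have "\<dots> \<le> card Y + h" using card_Un_le[of Y "{x + L..<x + L + h}"] by simp
    finally have "card ((+) h ` X - X) \<le> card Y + h" .
    then have "real (card ((+) h ` X - X)) \<le> real (card Y) + real hmax"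
      using le_max(2)[OF V] unfolding h_def by linarith
    also have "\<dots> \<le> W"
    proof -
      have "\<epsilon> * real L \<ge> 0" using pos(1) by simp
      then show ?thesis using Y L_big de unfolding W_def by linarith
    qed
    finally show ?thesis unfolding h_def .
  qed
  define N where "N = L + hmax + 1"
  have N: "L \<le> N" "0 < N" by (simp_all add: N_def)
  obtain w :: "nat \<Rightarrow> real" where w: "\<And>r. w r \<ge> 0" "(\<Sum>r<N. w r) = card X"
    "\<And>h. h + L \<le> N \<Longrightarrow> (\<Sum>r<N. w r * (1 - cos (2 * pi * (real r / real N) * real h))) = card ((+) h ` X - X)"
    by (rule spectral_weights[OF X(2) N]) (rule that)
  define t where "t r = real r / real N" for r
  have spectral: "(\<Sum>r<N. w r * chord (t r) h) = card ((+) h ` X - X)" if "h + L \<le> N" for h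
    unfolding chord_def t_def by (rule w(3)[OF that])
  have mass: "(\<Sum>r\<in>{r. r < N \<and> (\<exists>U\<in>\<F>. chord (t r) (\<Sum>U) > kappa)}. w r) \<le> 4 * W / kappa"
    if "\<F> = \<F>1 \<or> \<F> = \<F>2" for \<F>
  proof (rule family_mass)
    show "finite \<F>" "disjoint \<F>" using that \<F> by auto
    show "finite U" if "U \<in> \<F>" for U using \<F>E[of U] that \<open>\<F> = \<F>1 \<or> \<F> = \<F>2\<close> by auto
    show "(\<Sum>r<N. w r * chord (t r) (\<Sum>(\<Union>J))) \<le> W" if "J \<subseteq> \<F>" for J
    proof -
      have J: "\<Union>J \<in> H" using that \<open>\<F> = \<F>1 \<or> \<F> = \<F>2\<close> by (auto simp: H_def)
      then have "\<Sum>(\<Union>J) + L \<le> N" using le_max(2)[OF J] by (simp add: N_def)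
      then show ?thesis using shift[OF J] by (simp only: spectral)
    qed
  qed (rule w(1))
  define R where "R \<F> = {r. r < N \<and> (\<exists>U\<in>\<F>. chord (t r) (\<Sum>U) > kappa)}" for \<F>
  have "real (card ((+) 1 ` X - X)) = (\<Sum>r<N. w r * chord (t r) 1)"
    by (rule spectral[symmetric]) (simp add: N_def)
  \<comment> \<open>Frequencies near \<open>0\<close> contribute little because translation by 1 hardly turns them, all
    others because they have little mass.\<close>
  also have "\<dots> \<le> (\<Sum>r<N. \<gamma> * w r + 2 * (if r \<in> R \<F>1 then w r else 0) + 2 * (if r \<in> R \<F>2 then w r else 0))"
  proof (rule sum_mono)
    fix r assume r: "r \<in> {..<N}"
    show "w r * chord (t r) 1 \<le> \<gamma> * w r + 2 * (if r \<in> R \<F>1 then w r else 0) + 2 * (if r \<in> R \<F>2 then w r else 0)"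
    proof (cases "chord (t r) 1 < \<gamma>")
      case True
      then have "w r * chord (t r) 1 \<le> w r * \<gamma>" using w(1)[of r] by (intro mult_left_mono) auto
      then show ?thesis using w(1)[of r] by (auto simp: mult.commute)
    next
      case False
      have "t r \<in> {0..1}" using r by (auto simp: t_def)
      then have "r \<in> R \<F>1 \<or> r \<in> R \<F>2" using cover[of "t r"] False r by (auto simp: R_def)
      moreover have "w r * chord (t r) 1 \<le> w r * 2" using w(1)[of r] chord_le_2 by (intro mult_left_mono)
      moreover have "\<gamma> * w r \<ge> 0" using w(1)[of r] pos(2) by simp
      ultimately show ?thesis using w(1)[of r] by auto
    qed
  qed
  also have "\<dots> = \<gamma> * real (card X) + 2 * (\<Sum>r\<in>R \<F>1. w r) + 2 * (\<Sum>r\<in>R \<F>2. w r)"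
  proof -
    have "(\<Sum>r<N. if r \<in> R \<F> then w r else 0) = (\<Sum>r\<in>R \<F>. w r)" for \<F>
      by (subst sum.inter_filter[symmetric]) (auto intro!: sum.cong simp: R_def)
    then show ?thesis by (simp add: sum.distrib w(2) flip: sum_distrib_left)
  qed
  also have "\<dots> \<le> \<gamma> * real L + 16 * W / kappa"
  proof -
    have "\<gamma> * real (card X) \<le> \<gamma> * real L" using card_X_le pos(2) by (intro mult_left_mono) auto
    then show ?thesis using mass[of \<F>1] mass[of \<F>2] unfolding R_def by simp
  qed
  also have "\<dots> = \<delta> / (4 * real l) * real L"
    using kappa_bounds(1) \<open>l > 0\<close> by (simp add: W_def \<epsilon>_def \<gamma>_def field_simps)
  finally have ends: "real (card ((+) 1 ` X - X)) \<le> \<delta> / (4 * real l) * real L" .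
  have "T \<subseteq> subset_sums (B \<union> E)" unfolding T_def using F(2) by (intro subset_sums_mono) auto
  then have "\<not> {y..<y + l} \<subseteq> X" for y using no_run X(3) by blast
  then have "real (card X) \<le> real l * real (card ((+) 1 ` X - X))"
    using card_le_run_ends[OF X(1), of l] by (metis of_nat_le_iff of_nat_mult)
  also have "\<dots> \<le> real l * (\<delta> / (4 * real l) * real L)" using ends by (intro mult_left_mono) auto
  also have "\<dots> = \<delta> / 4 * real L" using \<open>l > 0\<close> by simp
  finally have "(d - \<epsilon>) * real L \<le> \<delta> / 4 * real L" using card_X by linarith
  then have "d - \<epsilon> \<le> \<delta> / 4" using \<open>L > 0\<close> by simp
  then show False using d \<open>\<epsilon> \<le> \<delta> / 2\<close> \<open>\<delta> > 0\<close> by linarith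
qed

section \<open>Completeness\<close>

definition from_octaves :: "nat \<Rightarrow> (nat \<Rightarrow> nat set) \<Rightarrow> nat set" where
  "from_octaves k0 Y = (\<Union>k\<in>{k0..}. Y k)"

lemma from_octaves_Int_octave:
  assumes "\<And>k. k \<ge> k0 \<Longrightarrow> Y k \<subseteq> octave k" "k \<ge> k0"
  shows "from_octaves k0 Y \<inter> octave k = Y k"
proof
  show "from_octaves k0 Y \<inter> octave k \<subseteq> Y k"
  proof
    fix a assume a: "a \<in> from_octaves k0 Y \<inter> octave k"
    then obtain k' where k': "k' \<ge> k0" "a \<in> Y k'" by (auto simp: from_octaves_def)
    then have "a \<in> octave k'" using assms(1) by blast
    then have "k' = k" using a octave_unique by blast
    then show "a \<in> Y k" using k' by simp
  qed
  show "Y k \<subseteq> from_octaves k0 Y \<inter> octave k"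
    using assms by (auto simp: from_octaves_def)
qed

lemma from_octaves_disjoint:
  assumes "\<And>k. k \<ge> k0 \<Longrightarrow> Y k \<subseteq> octave k" "\<And>k. k \<ge> k0 \<Longrightarrow> Z k \<subseteq> octave k"
    and "\<And>k. k \<ge> k0 \<Longrightarrow> Y k \<inter> Z k = {}"
  shows "from_octaves k0 Y \<inter> from_octaves k0 Z = {}"
proof (rule equals0I)
  fix a assume a: "a \<in> from_octaves k0 Y \<inter> from_octaves k0 Z"
  then obtain k where k: "k \<ge> k0" "a \<in> Y k" by (auto simp: from_octaves_def)
  then have "a \<in> octave k" using assms(1) by blast
  then have "a \<in> Z k" using a from_octaves_Int_octave[of k0 Z, OF assms(2) k(1)] by blast
  then show False using assms(3) k by blast
qed

text \<open>
  The octaves beyond \<open>m\<close> still carry a divergent sum, so finitely many of them contribute the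
  amount \<open>1/2\<close> that \<open>block_turning_far\<close> asks for.
\<close>

lemma block_from_divergence:
  fixes \<theta> :: real
  assumes Y: "\<And>k. k \<ge> k0 \<Longrightarrow> Y k \<subseteq> octave k"
    and div: "\<not> summable (\<lambda>k. if k \<ge> k0 then \<Sum>a\<in>Y k. dist_nearest_int (real a * \<theta>) else 0)"
  shows "\<exists>U. finite U \<and> U \<subseteq> from_octaves k0 Y \<inter> {m<..} \<and> chord \<theta> (\<Sum>U) \<ge> 1"
proof -
  let ?t = "\<lambda>k. if k \<ge> k0 then \<Sum>a\<in>Y k. dist_nearest_int (real a * \<theta>) else 0"
  define K where "K = max m k0"
  define G where "G n = (\<Union>k<n. Y (k + K))" for n
  have fin: "finite (Y (k + K))" for k
    using Y[of "k + K"] finite_subset[of "Y (k + K)" "octave (k + K)"] by (simp add: K_def)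
  have sum_G: "(\<Sum>a\<in>G n. dist_nearest_int (real a * \<theta>)) = (\<Sum>k<n. ?t (k + K))" for n
  proof -
    have "Y (i + K) \<inter> Y (j + K) = {}" if "i \<noteq> j" for i j
    proof (rule equals0I)
      fix a assume a: "a \<in> Y (i + K) \<inter> Y (j + K)"
      have "Y (i + K) \<subseteq> octave (i + K)" "Y (j + K) \<subseteq> octave (j + K)"
        by (rule Y, simp add: K_def)+
      then have "i + K = j + K" using a by (blast intro: octave_unique)
      then show False using that by simp
    qed
    then have "(\<Sum>a\<in>G n. dist_nearest_int (real a * \<theta>))
        = (\<Sum>k<n. \<Sum>a\<in>Y (k + K). dist_nearest_int (real a * \<theta>))"
      unfolding G_def using fin by (intro sum.UNION_disjoint) auto
    moreover have "k0 \<le> k + K" for k by (simp add: K_def)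
    ultimately show ?thesis by simp
  qed
  have "\<exists>n. (\<Sum>k<n. ?t (k + K)) \<ge> 1 / 2"
  proof (rule ccontr)
    assume "\<not> ?thesis"
    then have "(\<Sum>k<n. ?t (k + K)) \<le> 1 / 2" for n by (simp add: not_le less_imp_le)
    then have "summable (\<lambda>k. ?t (k + K))"
      by (intro summableI_nonneg_bounded[of _ "1 / 2"]) (auto intro!: sum_nonneg dist_nearest_int_nonneg)
    then have "summable ?t" by (rule summable_iff_shift[THEN iffD1])
    then show False using div by contradiction
  qed
  then obtain n where "(\<Sum>a\<in>G n. dist_nearest_int (real a * \<theta>)) \<ge> 1 / 2" unfolding sum_G ..
  moreover have "finite (G n)" using fin by (simp add: G_def)
  ultimately obtain U where U: "U \<subseteq> G n" "cos (2 * pi * \<theta> * real (\<Sum>U)) \<le> 0"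
    using block_turning_far by blast
  have "G n \<subseteq> from_octaves k0 Y \<inter> {m<..}"
  proof
    fix a assume "a \<in> G n"
    then obtain k where a: "a \<in> Y (k + K)" by (auto simp: G_def)
    have "k + K \<ge> k0" by (simp add: K_def)
    moreover have "a > 2 ^ (k + K)" using a Y[OF calculation] by auto
    moreover have "m \<le> k + K" by (simp add: K_def)
    then have "m < 2 ^ (k + K)" using less_exp[of "k + K"] by linarith
    ultimately show "a \<in> from_octaves k0 Y \<inter> {m<..}" using a by (auto simp: from_octaves_def)
  qed
  then have "U \<subseteq> from_octaves k0 Y \<inter> {m<..}" using U(1) by blast
  moreover have "finite U" using U(1) \<open>finite (G n)\<close> by (rule finite_subset)
  ultimately show ?thesis using U(2) by (intro exI[of _ U]) (simp add: chord_def)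
qed

text \<open>
  The four elements removed from each octave are shared equally between \<open>B\<close> and \<open>C\<close>, and \<open>E\<close> is
  the rest. A run in the subset sums of \<open>C \<union> E\<close> that is as long as the gaps in the subset sums of
  \<open>B\<close> allows every large number to be reached by one sum of each kind.
\<close>

lemma complete_set_of_divergent:
  fixes A :: "nat set"
  assumes five: "\<And>k. k \<ge> k0 \<Longrightarrow> card (A \<inter> octave k) \<ge> 5"
    and div: "\<And>\<theta>::real. \<theta> \<notin> \<int> \<Longrightarrow>
           (\<Sum>\<^sub>\<infinity>a\<in>A. ennreal (dist_nearest_int (real a * \<theta>))) = \<infinity>"
  shows "complete_set A"
proof -
  obtain R where R: "\<And>k. k \<ge> k0 \<Longrightarrow> R k \<subseteq> A \<inter> octave k \<and> card (R k) = 4"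
    and E_div: "\<And>\<theta>::real. \<theta> \<notin> \<int> \<Longrightarrow>
      \<not> summable (\<lambda>k. if k \<ge> k0 then \<Sum>a\<in>A \<inter> octave k - R k. dist_nearest_int (real a * \<theta>) else 0)"
    by (rule divergent_remainder[OF five not_summable_octaves[OF div]]) (assumption | rule that)+
  have "\<exists>P\<subseteq>R k. card P = 2" if "k \<ge> k0" for k
  proof -
    have "2 \<le> card (R k)" using R[OF that] by simp
    then show ?thesis by (rule obtain_subset_with_card_n) blast
  qed
  then have "\<forall>k\<in>{k0..}. \<exists>P. P \<subseteq> R k \<and> card P = 2" by blast
  then obtain P where P: "\<And>k. k \<ge> k0 \<Longrightarrow> P k \<subseteq> R k \<and> card (P k) = 2"
    unfolding bchoice_iff by auto
  define Y where "Y k = A \<inter> octave k - R k" for k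
  define B C E where "B = from_octaves k0 P" and "C = from_octaves k0 (\<lambda>k. R k - P k)"
    and "E = from_octaves k0 Y"
  have in_octave: "P k \<subseteq> octave k" "R k - P k \<subseteq> octave k" "Y k \<subseteq> octave k" if "k \<ge> k0" for k
    using R[OF that] P[OF that] by (auto simp: Y_def)
  have finite_R: "finite (R k)" if "k \<ge> k0" for k using R[OF that] card.infinite by fastforce
  have "C \<inter> E = {}" "B \<inter> (C \<union> E) = {}"
  proof -
    show "C \<inter> E = {}" unfolding C_def E_def
      by (rule from_octaves_disjoint[OF in_octave(2,3)]) (auto simp: Y_def)
    have "B \<inter> C = {}" unfolding B_def C_def
      by (rule from_octaves_disjoint[OF in_octave(1,2)]) auto
    moreover have "B \<inter> E = {}" unfolding B_def E_def
      by (rule from_octaves_disjoint[OF in_octave(1,3)]) (use P in \<open>auto simp: Y_def\<close>)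
    ultimately show "B \<inter> (C \<union> E) = {}" by blast
  qed
  have "B \<union> (C \<union> E) \<subseteq> A"
    using R P by (fastforce simp: B_def C_def E_def Y_def from_octaves_def)
  have "card (B \<inter> octave k) \<ge> 2" "card (C \<inter> octave k) \<ge> 2" if k: "k \<ge> k0" for k
  proof -
    have "finite (P k)" using P[OF k] finite_R[OF k] finite_subset by blast
    then have "card (R k - P k) = 2" using R[OF k] P[OF k] by (simp add: card_Diff_subset)
    moreover have "B \<inter> octave k = P k" "C \<inter> octave k = R k - P k"
      unfolding B_def C_def
      by (rule from_octaves_Int_octave[OF _ k], rule in_octave, assumption)+
    ultimately show "card (B \<inter> octave k) \<ge> 2" "card (C \<inter> octave k) \<ge> 2"
      using P[OF k] by simp_all
  qed
  note gap = this[THEN subset_sums_gap]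
  \<comment> \<open>One element of \<open>E\<close> in every octave, which gives a sequence with bounded ratios.\<close>
  define x where "x j = (SOME a. a \<in> Y (k0 + j))" for j
  have xY: "x j \<in> Y (k0 + j)" for j
  proof -
    have "card (R (k0 + j)) < card (A \<inter> octave (k0 + j))" using five[of "k0 + j"] R[of "k0 + j"] by simp
    moreover have "finite (R (k0 + j))" by (rule finite_R) simp
    ultimately have "\<not> A \<inter> octave (k0 + j) \<subseteq> R (k0 + j)"
      by (meson card_mono not_less)
    then have "Y (k0 + j) \<noteq> {}" unfolding Y_def by blast
    then show ?thesis unfolding x_def by (simp add: some_in_eq)
  qed
  have x: "2 ^ (k0 + j) < x j" "x j \<le> 2 ^ (k0 + j + 1)" for j
    using xY[of j] in_octave(3)[of "k0 + j"] by auto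
  have "dense_windows (subset_sums C) (1 / real (2 ^ (k0 + 1)))"
    by (rule dense_windows_of_gap) (use gap(2) in auto)
  then have "\<exists>y. {y..<y + 2 ^ (k0 + 1)} \<subseteq> subset_sums (C \<union> E)"
  proof (rule subset_sums_contain_long_runs[OF \<open>C \<inter> E = {}\<close>])
    fix \<gamma> :: real and m :: nat assume "\<gamma> > 0"
    show "\<exists>\<F>1 \<F>2. finite \<F>1 \<and> disjoint \<F>1 \<and> finite \<F>2 \<and> disjoint \<F>2 \<and>
      (\<forall>U\<in>\<F>1 \<union> \<F>2. finite U \<and> U \<subseteq> E \<inter> {m<..}) \<and>
      (\<forall>\<theta>\<in>{0..1}. chord \<theta> 1 \<ge> \<gamma> \<longrightarrow> (\<exists>U\<in>\<F>1 \<union> \<F>2. chord \<theta> (\<Sum>U) > kappa))"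
    proof (rule two_families[of x E \<gamma> m])
      show "x j \<in> E" "x (Suc j) \<le> 8 * x j" for j
        using xY[of j] x(1)[of j] x(2)[of "Suc j"] by (auto simp: E_def from_octaves_def)
      have "j \<le> x j" for j
        using x(1)[of j] less_exp[of "k0 + j"] by linarith
      then show "filterlim x at_top sequentially"
        by (intro filterlim_at_top_mono[OF filterlim_ident]) auto
      show "\<exists>U. finite U \<and> U \<subseteq> E \<inter> {m<..} \<and> chord \<theta> (\<Sum>U) \<ge> 1" if "\<theta> \<notin> \<int>" for \<theta> m
        unfolding E_def using E_div[OF that] in_octave(3) unfolding Y_def[symmetric]
        by (intro block_from_divergence)
      show "\<gamma> > 0" by fact
    qed blast
  qed simp
  then obtain y where y: "{y..<y + 2 ^ (k0 + 1)} \<subseteq> subset_sums (C \<union> E)" by blast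
  have "\<exists>S. finite S \<and> S \<subseteq> A \<and> n = \<Sum>S" if "n \<ge> y" for n
  proof -
    obtain s where s: "s \<in> subset_sums B" "s \<le> n - y" "n - y < s + 2 ^ (k0 + 1)"
      using gap(1) by blast
    then have "n - s \<in> {y..<y + 2 ^ (k0 + 1)}" using that by auto
    then have "s + (n - s) \<in> subset_sums (B \<union> (C \<union> E))"
      using y s(1) \<open>B \<inter> (C \<union> E) = {}\<close> by (intro subset_sums_add) auto
    then have "n \<in> subset_sums A"
      using s(2) subset_sums_mono[OF \<open>B \<union> (C \<union> E) \<subseteq> A\<close>] by auto
    then show ?thesis by (auto simp: subset_sums_def)
  qed
  then show ?thesis unfolding complete_set_def eventually_at_top_linorder by blast
qed

theorem corollary1p2:
  fixes A :: "nat set"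
  assumes "A \<subseteq> {1..}"
    and "\<And>\<theta>::real. \<theta> \<notin> \<int> \<Longrightarrow>
           (\<Sum>\<^sub>\<infinity>a\<in>A. ennreal (dist_nearest_int (real a * \<theta>))) = \<infinity>"
    and "\<forall>\<^sub>F k::nat in at_top. card (A \<inter> {2 ^ k <.. 2 ^ (k + 1)}) \<ge> 5"
  shows "strongly_complete_set A"
  unfolding strongly_complete_set_def
proof (intro allI impI)
  fix B assume B: "finite B \<and> B \<subseteq> A"
  obtain k1 where k1: "\<And>k. k \<ge> k1 \<Longrightarrow> card (A \<inter> octave k) \<ge> 5"
    using assms(3) unfolding eventually_at_top_linorder by blast
  obtain b where b: "\<forall>a\<in>B. a \<le> b" using B finite_nat_set_iff_bounded_le by blast
  show "complete_set (A - B)"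
  proof (rule complete_set_of_divergent)
    fix k assume k: "k \<ge> max k1 b"
    \<comment> \<open>Octaves beyond the finite set are not affected by its removal.\<close>
    have "b < 2 ^ k" using k less_exp[of k] by linarith
    then have "(A - B) \<inter> octave k = A \<inter> octave k" using b by fastforce
    then show "card ((A - B) \<inter> octave k) \<ge> 5" using k1[of k] k by simp
  next
    fix \<theta> :: real assume \<theta>: "\<theta> \<notin> \<int>"
    let ?f = "\<lambda>a. ennreal (dist_nearest_int (real a * \<theta>))"
    have "infsum ?f (A - B \<union> B) = infsum ?f (A - B) + infsum ?f B"
      by (intro infsum_Un_disjoint nonneg_summable_on_complete) auto
    moreover have "A - B \<union> B = A" using B by blast
    ultimately have "infsum ?f (A - B) + (\<Sum>a\<in>B. ?f a) = \<infinity>"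
      using assms(2)[OF \<theta>] B by simp
    moreover have "(\<Sum>a\<in>B. ?f a) \<noteq> \<infinity>" using B by simp
    ultimately show "infsum ?f (A - B) = \<infinity>" by simp
  qed
qed

end
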